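(* For each $w \in \{25, 27, 31, 33\}$ there is an integer $r_0(w)$ such that for every admissible integer $r \ge r_0(w)$, i.e. every integer $r\ge r_0(w)$ with $r(w+1-r) \equiv 0 \pmod 3$, there exists a generalized pentagonal geometry $\mathrm{PENT}(3,r,w)$ with deficiency graph of girth at least $5$.
   Context: A Steiner system $S(2,k,w)$ is a pair $(W,\mathcal{B})$ where $W$ is a set of $w$ points and $\mathcal{B}$ is a set of $k$-subsets of $W$ (blocks) such that each pair of distinct points of $W$ lies in exactly one block. A generalized pentagonal geometry $\mathrm{PENT}(k,r,w)$ (with $k\ge 2$, $w\ge k$) is a (nonempty) partial linear space, i.e. a set of points together with a set of lines (sets of points) such that any two distinct points lie on at most one common line, in which every line contains exactly $k$ points, every point is on exactly $r$ lines, and for each point $x$ the set $W_x$ of points $y \ne x$ that are not collinear with $x$ (i.e. not on a common line with $x$) is the point set of a Steiner system $S(2,k,w)$ all of whose blocks are lines of the geometry. The deficiency graph of such a geometry has the points as vertices, with two distinct points adjacent precisely when they are not collinear. Given $k$ and $w$, $r$ is called admissible if $r(w+1-r)\equiv 0 \pmod k$. *)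

theory Defs
  imports "HOL-Number_Theory.Cong" "HOL-Library.Extended_Nat"
begin

definition steiner_system_2 :: "nat \<Rightarrow> nat \<Rightarrow> 'a set \<Rightarrow> 'a set set \<Rightarrow> bool" where
  "steiner_system_2 k w W B \<longleftrightarrow>
     finite W \<and> card W = w \<and>
     (\<forall>b\<in>B. b \<subseteq> W \<and> finite b \<and> card b = k) \<and>
     (\<forall>x\<in>W. \<forall>y\<in>W. x \<noteq> y \<longrightarrow> (\<exists>!b. b \<in> B \<and> x \<in> b \<and> y \<in> b))"

definition partial_linear_space :: "'a set \<Rightarrow> 'a set set \<Rightarrow> bool" where
  "partial_linear_space P L \<longleftrightarrow>
     (\<forall>l\<in>L. l \<subseteq> P) \<and>
     (\<forall>x\<in>P. \<forall>y\<in>P. x \<noteq> y \<longrightarrow>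
        (\<forall>l\<in>L. \<forall>m\<in>L. x \<in> l \<and> y \<in> l \<and> x \<in> m \<and> y \<in> m \<longrightarrow> l = m))"

definition collinear_pts :: "'a set set \<Rightarrow> 'a \<Rightarrow> 'a \<Rightarrow> bool" where
  "collinear_pts L x y \<longleftrightarrow> (\<exists>l\<in>L. x \<in> l \<and> y \<in> l)"

text \<open>The point set is not required to be finite explicitly: for finite \<open>k\<close>, \<open>r\<close>, \<open>w\<close> this follows,
  since a point is collinear with \<open>r * (k - 1)\<close> other points and not collinear with \<open>w\<close> others.\<close>

definition PENT :: "nat \<Rightarrow> nat \<Rightarrow> nat \<Rightarrow> 'a set \<Rightarrow> 'a set set \<Rightarrow> bool" where
  "PENT k r w P L \<longleftrightarrow>
     2 \<le> k \<and> k \<le> w \<and> P \<noteq> {} \<and>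
     partial_linear_space P L \<and>
     (\<forall>l\<in>L. finite l \<and> card l = k) \<and>
     (\<forall>x\<in>P. finite {l \<in> L. x \<in> l} \<and> card {l \<in> L. x \<in> l} = r) \<and>
     (\<forall>x\<in>P. \<exists>B\<subseteq>L. steiner_system_2 k w {y \<in> P. y \<noteq> x \<and> \<not> collinear_pts L x y} B)"

definition deficiency_adj :: "'a set \<Rightarrow> 'a set set \<Rightarrow> 'a \<Rightarrow> 'a \<Rightarrow> bool" where
  "deficiency_adj P L x y \<longleftrightarrow> x \<in> P \<and> y \<in> P \<and> x \<noteq> y \<and> \<not> collinear_pts L x y"

text \<open>Simple graphs are given by their (symmetric, irreflexive) adjacency relation. A cycle is the
  list of its distinct vertices in cyclic order, so its length is the length of the list.\<close>

definition graph_cycle :: "('a \<Rightarrow> 'a \<Rightarrow> bool) \<Rightarrow> 'a list \<Rightarrow> bool" where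
  "graph_cycle E c \<longleftrightarrow>
     3 \<le> length c \<and> distinct c \<and> (\<forall>i<length c. E (c ! i) (c ! (Suc i mod length c)))"

text \<open>The infimum of the empty set in \<^typ>\<open>enat\<close> is \<open>\<infinity>\<close>, so acyclic graphs have infinite girth.\<close>

definition girth :: "('a \<Rightarrow> 'a \<Rightarrow> bool) \<Rightarrow> enat" where
  "girth E = (INF c \<in> {c. graph_cycle E c}. enat (length c))"

text \<open>Integers are used because \<open>w + 1 - r\<close> is negative for large \<open>r\<close>.\<close>

definition admissible :: "nat \<Rightarrow> nat \<Rightarrow> nat \<Rightarrow> bool" where
  "admissible k w r \<longleftrightarrow> [int r * (int w + 1 - int r) = 0] (mod int k)"

end

theory Submission
  imports Defs
begin

text \<open>
  A \<open>PENT(3,r,w)\<close> whose deficiency graph has girth at least 5 is the same thing as a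
  \<open>w\<close>-regular graph without triangles and 4-cycles on \<open>v = 2r + w + 1\<close> points,
  a Steiner triple system on each neighbourhood, and a decomposition into triples of the pairs at
  distance at least three. (Two neighbourhoods share at most one point, so their triple systems never
  interfere.) The theorem follows from a recursion on such structures and, for each \<open>w\<close>,
  two examples to start it.

  \<^bold>\<open>Recursion.\<close> Put such geometries on the groups of a group divisible design with
  blocks of size three. Points of different groups are joined by the blocks of the design, so the
  deficiency graph of the whole is the disjoint union of the old ones: \<open>w\<close>, the
  neighbourhoods and the girth stay the same (\<open>deficiency_order_gdd\<close>). Let \<open>V =
  v/2\<close>. Three families of designs are used. Three equal groups lead from \<open>V\<close> to
  \<open>3V\<close>; Bose's Steiner triple system on \<open>6k + 3\<close> points with one point
  deleted, each remaining point replaced by \<open>V\<close> copies, leads from \<open>V\<close> to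
  \<open>(3k + 1)V\<close>; a transversal design with four groups, one of them truncated, leads from an
  odd \<open>N\<close> and some \<open>s \<le> N\<close> to \<open>3N + s\<close>. If \<open>a\<close>
  and \<open>b\<close> are attained, coprime to each other and to 6, and congruent modulo 3, then every
  large \<open>V\<close> congruent to \<open>0\<close> or \<open>a\<close> modulo 3 is of the form
  \<open>3ua + u'b\<close> with multipliers \<open>u\<close>, \<open>u'\<close> obtained from these
  steps (\<open>deficiency_order_all_large\<close>). For the base cases below these two classes are the
  ones that admissibility of \<open>r = V - (w + 1)/2\<close> allows.

  \<^bold>\<open>Base cases.\<close> Take two copies of the integers modulo \<open>n\<close> and join
  \<open>(0, x)\<close> to \<open>(1, x + d)\<close> for \<open>d\<close> in a \<open>w\<close>-element
  set \<open>D\<close> whose differences are distinct modulo \<open>n\<close>. This graph has girth at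
  least six. Triples are obtained by translating base triples modulo \<open>n\<close>, and all that
  matters is that every ordered difference between two points (of given sides) which is neither zero nor
  an edge occurs exactly once among the base triples (\<open>deficiency_op_develop\<close>). A cyclic
  Steiner triple system on \<open>D\<close> and its mirror image on \<open>-D\<close> provide the
  triples inside neighbourhoods. The other base triples have, in general, two points on one side and one
  on the other; such a triple uses two of the \<open>n - w\<close> remaining mixed differences and one
  of the \<open>n - 1 - w(w - 1)\<close> remaining pure differences (up to sign, counting both sides).
  These numbers fit exactly when \<open>n = 2w\<^sup>2 - 3w + 2\<close>, and for this \<open>n\<close>
  and for \<open>n + 6\<close>, where three pure differences are left over for one more triple, suitable
  base triples were found by computer; since they are coprime to 6, these two moduli are coprime to each
  other.
\<close>
section \<open>Geometries as partial operations\<close>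

text \<open>
  The geometry is encoded by the relation \<open>E\<close> of being distinct and not collinear, and by
  the map \<open>t\<close> taking two distinct collinear points to the third point of their line. The
  last two equations say that the result does not depend on which two points of the line are given, so
  that lines never have to be counted or compared: recursive constructions become case distinctions on
  \<open>t\<close>. The condition on two neighbours \<open>y\<close>, \<open>z\<close> of
  \<open>x\<close> excludes triangles, makes neighbourhoods closed under \<open>t\<close> (so that they
  carry Steiner triple systems), and excludes 4-cycles.
\<close>
definition deficiency_op :: "nat \<Rightarrow> 'a set \<Rightarrow> ('a \<Rightarrow> 'a \<Rightarrow> bool) \<Rightarrow> ('a \<Rightarrow> 'a \<Rightarrow> 'a) \<Rightarrow> bool" where
  "deficiency_op w P E t \<longleftrightarrow>
     finite P \<and>
     (\<forall>x\<in>P. card {y \<in> P. E x y} = w) \<and>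
     (\<forall>x\<in>P. \<forall>y\<in>P. E x y \<longrightarrow> E y x \<and> x \<noteq> y) \<and>
     (\<forall>x\<in>P. \<forall>y\<in>P. \<forall>z\<in>P. E x y \<and> E x z \<and> y \<noteq> z \<longrightarrow>
        \<not> E y z \<and> E x (t y z) \<and> (\<forall>u\<in>P. E u y \<and> E u z \<longrightarrow> u = x)) \<and>
     (\<forall>x\<in>P. \<forall>y\<in>P. x \<noteq> y \<and> \<not> E x y \<longrightarrow>
        t x y \<in> P \<and> t x y \<noteq> x \<and> \<not> E x (t x y) \<and> t y x = t x y \<and> t x (t x y) = y)"

lemma deficiency_opD:
  assumes "deficiency_op w P E t"
  shows "finite P"
    and "x \<in> P \<Longrightarrow> card {y \<in> P. E x y} = w"
    and "x \<in> P \<Longrightarrow> y \<in> P \<Longrightarrow> E x y \<Longrightarrow> E y x"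
    and "x \<in> P \<Longrightarrow> \<not> E x x"
    and "x \<in> P \<Longrightarrow> y \<in> P \<Longrightarrow> z \<in> P \<Longrightarrow> E x y \<Longrightarrow> E x z \<Longrightarrow> y \<noteq> z \<Longrightarrow> \<not> E y z"
    and "x \<in> P \<Longrightarrow> y \<in> P \<Longrightarrow> z \<in> P \<Longrightarrow> E x y \<Longrightarrow> E x z \<Longrightarrow> y \<noteq> z \<Longrightarrow> E x (t y z)"
    and "x \<in> P \<Longrightarrow> u \<in> P \<Longrightarrow> y \<in> P \<Longrightarrow> z \<in> P \<Longrightarrow> E x y \<Longrightarrow> E x z \<Longrightarrow> E u y \<Longrightarrow> E u z \<Longrightarrow> y \<noteq> z
           \<Longrightarrow> u = x"
    and "x \<in> P \<Longrightarrow> y \<in> P \<Longrightarrow> x \<noteq> y \<Longrightarrow> \<not> E x y \<Longrightarrow> t x y \<in> P"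
    and "x \<in> P \<Longrightarrow> y \<in> P \<Longrightarrow> x \<noteq> y \<Longrightarrow> \<not> E x y \<Longrightarrow> t x y \<noteq> x"
    and "x \<in> P \<Longrightarrow> y \<in> P \<Longrightarrow> x \<noteq> y \<Longrightarrow> \<not> E x y \<Longrightarrow> \<not> E x (t x y)"
    and "x \<in> P \<Longrightarrow> y \<in> P \<Longrightarrow> x \<noteq> y \<Longrightarrow> \<not> E x y \<Longrightarrow> t y x = t x y"
    and "x \<in> P \<Longrightarrow> y \<in> P \<Longrightarrow> x \<noteq> y \<Longrightarrow> \<not> E x y \<Longrightarrow> t x (t x y) = y"
  using assms unfolding deficiency_op_def by blast+

definition op_lines :: "'a set \<Rightarrow> ('a \<Rightarrow> 'a \<Rightarrow> bool) \<Rightarrow> ('a \<Rightarrow> 'a \<Rightarrow> 'a) \<Rightarrow> 'a set set" where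
  "op_lines P E t = {{x, y, t x y} | x y. x \<in> P \<and> y \<in> P \<and> x \<noteq> y \<and> \<not> E x y}"

text \<open>
  Any two points of a line \<open>{x, y, t x y}\<close> yield the same line, because the three points
  are permuted by \<open>t\<close>: \<open>t x (t x y) = y\<close> and \<open>t y (t x y) = t y (t y x)
  = x\<close>.
\<close>
lemma op_lines_through:
  assumes op: "deficiency_op w P E t" and b: "b \<in> op_lines P E t"
  shows "b \<subseteq> P" and "card b = 3"
    and "p \<in> b \<Longrightarrow> q \<in> b \<Longrightarrow> p \<noteq> q \<Longrightarrow> \<not> E p q \<and> b = {p, q, t p q}"
proof -
  note D = deficiency_opD[OF op]
  obtain x y where xy: "x \<in> P" "y \<in> P" "x \<noteq> y" "\<not> E x y" and beq: "b = {x, y, t x y}"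
    using b by (auto simp: op_lines_def)
  define z where "z = t x y"
  have nyx: "\<not> E y x" using D(3) xy by blast
  have z: "z \<in> P" "z \<noteq> x" "\<not> E x z" "t y x = z" "t x z = y"
    using D(8-12)[OF xy] by (auto simp: z_def)
  have zy: "z \<noteq> y" "\<not> E y z" "t y z = x"
    using D(8-12)[OF xy(2) xy(1) _ nyx] xy(3) z(4) by auto
  have s: "t z x = y" "t z y = x"
    using D(11)[of x z] D(11)[of y z] z zy xy by auto
  have ns: "\<not> E z x" "\<not> E z y" using D(3) z zy xy by blast+
  have b': "b = {x, y, z}" by (simp add: beq z_def)
  show "b \<subseteq> P" using b' xy z by auto
  show "card b = 3" using b' xy z zy by auto
  show "\<not> E p q \<and> b = {p, q, t p q}" if "p \<in> b" "q \<in> b" "p \<noteq> q"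
    using that z zy s ns xy nyx unfolding b' z_def by auto
qed

lemma op_lines_joining:
  assumes "x \<in> P" "y \<in> P" "x \<noteq> y" "\<not> E x y"
  shows "{x, y, t x y} \<in> op_lines P E t"
  using assms unfolding op_lines_def by blast

text \<open>
  The degree \<open>r\<close> comes from a count: the lines through \<open>x\<close>, with
  \<open>x\<close> removed, partition the \<open>2 r\<close> points that are collinear with
  \<open>x\<close> into pairs. The triples inside the neighbourhood of \<open>x\<close> form its Steiner
  system, since the neighbourhood is closed under \<open>t\<close>.
\<close>
lemma deficiency_op_imp_PENT:
  assumes op: "deficiency_op w P E t" and w: "3 \<le> w" and v: "card P = 2 * r + w + 1"
  shows "PENT 3 r w P (op_lines P E t)"
    and "girth (deficiency_adj P (op_lines P E t)) \<ge> 5"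
proof -
  note D = deficiency_opD[OF op]
  define L where "L = op_lines P E t"
  note Lt = op_lines_through[OF op, folded L_def]
  note Lj = op_lines_joining[where P = P and E = E and t = t, folded L_def]
  have col: "collinear_pts L x y \<longleftrightarrow> \<not> E x y" if "x \<in> P" "y \<in> P" "x \<noteq> y" for x y
    using that Lt(3) Lj[OF that] unfolding collinear_pts_def by blast
  have adj: "deficiency_adj P L x y \<longleftrightarrow> x \<in> P \<and> y \<in> P \<and> E x y" for x y
    using col D(4) unfolding deficiency_adj_def by blast
  have Pne: "P \<noteq> {}" using v by auto
  have fin3: "finite l \<and> card l = 3" if "l \<in> L" for l
    using Lt(1,2)[OF that] D(1) finite_subset by blast
  have pls: "partial_linear_space P L"
    unfolding partial_linear_space_def using Lt(1,3) by metis
  have deg: "finite {l \<in> L. x \<in> l} \<and> card {l \<in> L. x \<in> l} = r" if x: "x \<in> P" for x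
  proof -
    let ?Lx = "{l \<in> L. x \<in> l}"
    have "?Lx \<subseteq> Pow P" using Lt(1) by blast
    then have f: "finite ?Lx" using D(1) finite_subset by blast
    have U: "(\<Union>l\<in>?Lx. l - {x}) = P - {x} - {y \<in> P. E x y}"
    proof (intro subset_antisym subsetI)
      fix y assume "y \<in> (\<Union>l\<in>?Lx. l - {x})"
      then obtain l where l: "l \<in> L" "x \<in> l" "y \<in> l" "x \<noteq> y" by blast
      then show "y \<in> P - {x} - {y \<in> P. E x y}" using Lt(1) Lt(3)[OF l] by blast
    next
      fix y assume "y \<in> P - {x} - {y \<in> P. E x y}"
      then have y: "y \<in> P" "x \<noteq> y" "\<not> E x y" by auto
      show "y \<in> (\<Union>l\<in>?Lx. l - {x})" using Lj[OF x y] y by blast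
    qed
    have "card (\<Union>l\<in>?Lx. l - {x}) = (\<Sum>l\<in>?Lx. card (l - {x}))"
    proof (rule card_UN_disjoint[OF f])
      show "\<forall>i\<in>?Lx. finite (i - {x})" using fin3 by blast
      show "\<forall>i\<in>?Lx. \<forall>j\<in>?Lx. i \<noteq> j \<longrightarrow> (i - {x}) \<inter> (j - {x}) = {}"
      proof (intro ballI impI, rule ccontr)
        fix i j assume ij: "i \<in> ?Lx" "j \<in> ?Lx" "i \<noteq> j" and "(i - {x}) \<inter> (j - {x}) \<noteq> {}"
        then obtain y where y: "y \<in> i" "y \<in> j" "y \<noteq> x" by blast
        then have "i = {x, y, t x y}" "j = {x, y, t x y}" using Lt(3)[of _ x y] ij by auto
        then show False using ij by simp
      qed
    qed
    also have "\<dots> = (\<Sum>l\<in>?Lx. 2)"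
      by (rule sum.cong) (use fin3 in auto)
    also have "\<dots> = 2 * card ?Lx" by simp
    finally have "2 * card ?Lx = card (P - {x} - {y \<in> P. E x y})" using U by simp
    also have "\<dots> = card (P - {x}) - card {y \<in> P. E x y}"
      by (rule card_Diff_subset) (use D(1,4) x in auto)
    also have "\<dots> = 2 * r" by (simp add: card_Diff_singleton x v D(2)[OF x])
    finally show ?thesis using f by simp
  qed
  have st: "\<exists>B\<subseteq>L. steiner_system_2 3 w {y \<in> P. y \<noteq> x \<and> \<not> collinear_pts L x y} B" if x: "x \<in> P" for x
  proof -
    define N where "N = {y \<in> P. E x y}"
    have N: "{y \<in> P. y \<noteq> x \<and> \<not> collinear_pts L x y} = N"
      unfolding N_def using col[OF x] D(4)[OF x] by auto
    have "\<exists>!b. b \<in> {b \<in> L. b \<subseteq> N} \<and> y \<in> b \<and> z \<in> b" if "y \<in> N" "z \<in> N" "y \<noteq> z" for y z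
    proof (rule ex1I)
      have yz: "y \<in> P" "z \<in> P" "E x y" "E x z" using that by (auto simp: N_def)
      have nE: "\<not> E y z" using D(5)[OF x yz that(3)] .
      show "{y, z, t y z} \<in> {b \<in> L. b \<subseteq> N} \<and> y \<in> {y, z, t y z} \<and> z \<in> {y, z, t y z}"
        using that yz nE Lj[OF yz(1,2) that(3) nE] D(6)[OF x yz that(3)] D(8)[OF yz(1,2) that(3) nE]
        by (auto simp: N_def)
      show "b = {y, z, t y z}" if "b \<in> {b \<in> L. b \<subseteq> N} \<and> y \<in> b \<and> z \<in> b" for b
        using Lt(3)[of b y z] that \<open>y \<noteq> z\<close> by blast
    qed
    then have "steiner_system_2 3 w N {b \<in> L. b \<subseteq> N}"
      unfolding steiner_system_2_def using fin3 D(1) D(2)[OF x] by (auto simp: N_def)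
    then show ?thesis unfolding N by (intro exI[of _ "{b \<in> L. b \<subseteq> N}"]) auto
  qed
  show "PENT 3 r w P (op_lines P E t)"
    unfolding PENT_def using w Pne pls fin3 deg st by (simp add: L_def)
  have "enat 5 \<le> enat (length c)" if c: "graph_cycle (deficiency_adj P L) c" for c
  proof (rule ccontr)
    assume "\<not> enat 5 \<le> enat (length c)"
    then have "length c = 3 \<or> length c = 4" using c unfolding graph_cycle_def by auto
    moreover have e: "\<forall>i<length c. c ! i \<in> P \<and> E (c ! i) (c ! (Suc i mod length c))"
      and d: "distinct c" using c adj unfolding graph_cycle_def by auto
    ultimately show False
    proof (elim disjE)
      assume "length c = 3"
      then obtain c0 c1 c2 where c': "c = [c0, c1, c2]"
        by (auto simp: numeral_3_eq_3 length_Suc_conv)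
      have "c0 \<in> P" "c1 \<in> P" "c2 \<in> P" "E c0 c1" "E c1 c2" "E c2 c0" "c2 \<noteq> c0"
        using e[rule_format, of 0] e[rule_format, of 1] e[rule_format, of 2] d by (auto simp: c')
      then show False using D(5)[of c1 c2 c0] D(3)[of c0 c1] by simp
    next
      assume "length c = 4"
      then obtain c0 c1 c2 c3 where c': "c = [c0, c1, c2, c3]"
        by (auto simp: numeral_eq_Suc length_Suc_conv)
      have "c0 \<in> P" "c1 \<in> P" "c2 \<in> P" "c3 \<in> P" "E c0 c1" "E c1 c2" "E c2 c3" "E c3 c0"
          "c1 \<noteq> c3" "c0 \<noteq> c2"
        using e[rule_format, of 0] e[rule_format, of 1] e[rule_format, of 2] e[rule_format, of 3] d
        by (auto simp: c')
      then show False using D(7)[of c0 c2 c1 c3] D(3)[of c1 c2] D(3)[of c3 c0] by simp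
    qed
  qed
  then have "enat 5 \<le> girth (deficiency_adj P L)"
    unfolding girth_def by (intro INF_greatest) auto
  then show "girth (deficiency_adj P (op_lines P E t)) \<ge> 5" by (simp add: L_def numeral_eq_enat)
qed

lemma deficiency_op_transport:
  assumes op: "deficiency_op w P E t" and f: "bij_betw f P A"
  shows "\<exists>E t. deficiency_op w A E t"
proof -
  note D = deficiency_opD[OF op]
  define g where "g = inv_into P f"
  have g: "g a \<in> P" "f (g a) = a" if "a \<in> A" for a
    using f that unfolding g_def bij_betw_def by (auto simp: inv_into_into f_inv_into_f)
  have fA: "f x \<in> A" "g (f x) = x" if "x \<in> P" for x
    using f that unfolding g_def bij_betw_def by auto
  have gi: "g a = g b \<longleftrightarrow> a = b" if "a \<in> A" "b \<in> A" for a b using g that by metis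
  have "deficiency_op w A (\<lambda>a b. E (g a) (g b)) (\<lambda>a b. f (t (g a) (g b)))"
    unfolding deficiency_op_def
  proof (intro conjI ballI impI; (elim conjE)?)
    show "finite A" using f D(1) bij_betw_finite by blast
    fix a assume a: "a \<in> A"
    have "bij_betw f {y \<in> P. E (g a) y} {b \<in> A. E (g a) (g b)}"
      by (rule bij_betw_byWitness[where f' = g]) (use fA g in auto)
    then show "card {b \<in> A. E (g a) (g b)} = w"
      using bij_betw_same_card D(2)[OF g(1)[OF a]] by fastforce
    fix b assume b: "b \<in> A"
    show "E (g b) (g a)" "a \<noteq> b" if "E (g a) (g b)" using D(3,4) that g a b by blast+
    { assume "a \<noteq> b" "\<not> E (g a) (g b)"
      then have h: "g a \<in> P" "g b \<in> P" "g a \<noteq> g b" "\<not> E (g a) (g b)" using gi a b g by auto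
      have "t (g a) (g b) \<in> P" using D(8)[OF h] .
      then show "f (t (g a) (g b)) \<in> A" "f (t (g a) (g b)) \<noteq> a" "\<not> E (g a) (g (f (t (g a) (g b))))"
         "f (t (g b) (g a)) = f (t (g a) (g b))" "f (t (g a) (g (f (t (g a) (g b))))) = b"
        using D(9-12)[OF h] fA g a b by metis+ }
    fix c assume c: "c \<in> A"
    assume "E (g a) (g b)" "E (g a) (g c)" "b \<noteq> c"
    then have h: "g a \<in> P" "g b \<in> P" "g c \<in> P" "E (g a) (g b)" "E (g a) (g c)" "g b \<noteq> g c"
      using gi g a b c by auto
    show n: "\<not> E (g b) (g c)" using D(5)[OF h] .
    show "E (g a) (g (f (t (g b) (g c))))" using D(6)[OF h] D(8)[OF h(2,3,6) n] fA by simp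
    show "u = a" if "u \<in> A" "E (g u) (g b)" "E (g u) (g c)" for u
      using D(7)[of "g a" "g u" "g b" "g c"] h that g gi a by blast
  qed
  then show ?thesis by blast
qed

text \<open>
  Only the number of points matters for the recursion, since points can be renamed. Points are natural
  numbers here so that the existential quantifier ranges over a single type.
\<close>
definition deficiency_order :: "nat \<Rightarrow> nat \<Rightarrow> bool" where
  "deficiency_order w v \<longleftrightarrow> (\<exists>(P :: nat set) E t. deficiency_op w P E t \<and> card P = v)"

lemma deficiency_orderI:
  assumes "deficiency_op w P E t" "card P = v"
  shows "deficiency_order w v"
proof -
  obtain f where "bij_betw f P {0..<v}"
    using ex_bij_betw_finite_nat[OF deficiency_opD(1)[OF assms(1)]] assms(2) by blast
  from deficiency_op_transport[OF assms(1) this] show ?thesis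
    unfolding deficiency_order_def by (metis card_atLeastLessThan diff_zero)
qed

lemma deficiency_orderE:
  assumes "deficiency_order w v" "finite A" "card A = v"
  shows "\<exists>E t. deficiency_op w A E t"
proof -
  obtain P :: "nat set" and E t where P: "deficiency_op w P E t" "card P = v"
    using assms(1) unfolding deficiency_order_def by blast
  then obtain f where "bij_betw f P A"
    using finite_same_card_bij[OF deficiency_opD(1)[OF P(1)] assms(2)] assms(3) by auto
  then show ?thesis using deficiency_op_transport[OF P(1)] by blast
qed

section \<open>Group divisible designs\<close>

text \<open>
  A group divisible design with blocks of size three, given again by the third point of the block
  through two points of different groups. The map \<open>g\<close> sends a point to (a name of) its
  group. Distinctness of the third group from the group of \<open>y\<close> follows by symmetry.
\<close>
definition gdd_op :: "'a set \<Rightarrow> ('a \<Rightarrow> 'g) \<Rightarrow> ('a \<Rightarrow> 'a \<Rightarrow> 'a) \<Rightarrow> bool" where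
  "gdd_op X g t \<longleftrightarrow> finite X \<and>
     (\<forall>x\<in>X. \<forall>y\<in>X. g x \<noteq> g y \<longrightarrow>
        t x y \<in> X \<and> g (t x y) \<noteq> g x \<and> t y x = t x y \<and> t x (t x y) = y)"

lemma gdd_opD:
  assumes "gdd_op X g t"
  shows "finite X"
    and "x \<in> X \<Longrightarrow> y \<in> X \<Longrightarrow> g x \<noteq> g y \<Longrightarrow> t x y \<in> X"
    and "x \<in> X \<Longrightarrow> y \<in> X \<Longrightarrow> g x \<noteq> g y \<Longrightarrow> g (t x y) \<noteq> g x"
    and "x \<in> X \<Longrightarrow> y \<in> X \<Longrightarrow> g x \<noteq> g y \<Longrightarrow> t y x = t x y"
    and "x \<in> X \<Longrightarrow> y \<in> X \<Longrightarrow> g x \<noteq> g y \<Longrightarrow> t x (t x y) = y"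
  using assms unfolding gdd_op_def by blast+

text \<open>
  The graph of the union is the disjoint union of the graphs on the groups, since the design makes
  points of different groups collinear. All local conditions are thus inherited from a single group.
\<close>
lemma deficiency_order_gdd:
  assumes gdd: "gdd_op X g t"
    and groups: "\<And>i. i \<in> g ` X \<Longrightarrow> deficiency_order w (card {x \<in> X. g x = i})"
  shows "deficiency_order w (card X)"
proof -
  note G = gdd_opD[OF gdd]
  let ?G = "\<lambda>i. {x \<in> X. g x = i}"
  have "\<exists>E u. deficiency_op w (?G i) E u" if "i \<in> g ` X" for i
    by (rule deficiency_orderE[OF groups[OF that]]) (use G(1) in auto)
  then obtain E u where Eu: "\<And>i. i \<in> g ` X \<Longrightarrow> deficiency_op w (?G i) (E i) (u i)"
    by metis
  define F where "F x y \<longleftrightarrow> g x = g y \<and> E (g x) x y" for x y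
  define s where "s x y = (if g x = g y then u (g x) x y else t x y)" for x y
  have D: "deficiency_op w (?G (g x)) (E (g x)) (u (g x))" if "x \<in> X" for x
    using Eu that by blast
  have "deficiency_op w X F s"
    unfolding deficiency_op_def
  proof (intro conjI ballI impI; (elim conjE)?)
    show "finite X" by (rule G(1))
    fix x assume x: "x \<in> X"
    note Dx = deficiency_opD[OF D[OF x]]
    have "{y \<in> X. F x y} = {y \<in> ?G (g x). E (g x) x y}" by (auto simp: F_def)
    then show "card {y \<in> X. F x y} = w" using Dx(2)[of x] x by simp
    fix y assume y: "y \<in> X"
    show "F y x" "x \<noteq> y" if "F x y"
      using that Dx(3)[of x y] Dx(4)[of x] x y unfolding F_def by auto
    { assume xy: "x \<noteq> y" "\<not> F x y"
      have "s x y \<in> X \<and> s x y \<noteq> x \<and> \<not> F x (s x y) \<and> s y x = s x y \<and> s x (s x y) = y"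
      proof (cases "g x = g y")
        case True
        then have h: "x \<in> ?G (g x)" "y \<in> ?G (g x)" "x \<noteq> y" "\<not> E (g x) x y"
          using x y xy by (auto simp: F_def)
        show ?thesis using Dx(8-12)[OF h] True by (auto simp: F_def s_def)
      next
        case False
        then show ?thesis using G(2-5)[OF x y False] by (auto simp: F_def s_def)
      qed
      then show "s x y \<in> X" "s x y \<noteq> x" "\<not> F x (s x y)" "s y x = s x y" "s x (s x y) = y"
        by auto }
    fix z assume z: "z \<in> X"
    assume F: "F x y" "F x z" "y \<noteq> z"
    then have h: "x \<in> ?G (g x)" "y \<in> ?G (g x)" "z \<in> ?G (g x)" "E (g x) x y" "E (g x) x z" "y \<noteq> z"
      using x y z by (auto simp: F_def)
    have n: "\<not> E (g x) y z" using Dx(5)[OF h] .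
    then show "\<not> F y z" using h by (auto simp: F_def)
    show "F x (s y z)" using Dx(6)[OF h] Dx(8)[OF h(2,3,6) n] h by (auto simp: F_def s_def)
    show "v = x" if "v \<in> X" "F v y" "F v z" for v
      using Dx(7)[of x v y z] that h by (auto simp: F_def)
  qed
  then show ?thesis by (rule deficiency_orderI) simp
qed

text \<open>
  Wilson's weighting: every point is replaced by \<open>c\<close> copies, every block by the Latin
  square \<open>i + j + k \<equiv> 0\<close> modulo \<open>c\<close>. This Latin square is symmetric in
  its three coordinates, so no order on the points of a block is needed. The summand \<open>2 *
  c\<close> only keeps the subtraction nonnegative.
\<close>
lemma gdd_op_weight:
  fixes c :: nat
  assumes gdd: "gdd_op X g t"
  shows "gdd_op (X \<times> {..<c}) (\<lambda>p. g (fst p))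
           (\<lambda>p q. (t (fst p) (fst q), (2 * c - snd p - snd q) mod c))"
  unfolding gdd_op_def
proof (intro conjI ballI impI)
  note G = gdd_opD[OF gdd]
  show "finite (X \<times> {..<c})" using G(1) by simp
  fix p q assume "p \<in> X \<times> {..<c}" "q \<in> X \<times> {..<c}" and d: "g (fst p) \<noteq> g (fst q)"
  then obtain x i y j where pq: "p = (x, i)" "q = (y, j)" "x \<in> X" "y \<in> X" "i < c" "j < c" by auto
  have ij: "(2 * c - i - (2 * c - i - j) mod c) mod c = j" if "i < c" "j < c" for i j
  proof -
    define m where "m = (2 * c - i - j) mod c"
    have "m < c" using that by (simp add: m_def)
    have "[int m = 2 * int c - int i - int j] (mod int c)"
      using that by (simp add: m_def cong_def zmod_int of_nat_diff algebra_simps)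
    then have "[2 * int c - int i - int m = 2 * int c - int i - (2 * int c - int i - int j)] (mod int c)"
      by (intro cong_diff cong_refl)
    then have "[int (2 * c - i - m) = int j] (mod int c)"
      using that \<open>m < c\<close> by (simp add: of_nat_diff algebra_simps)
    then show ?thesis using that unfolding m_def[symmetric] cong_int_iff by (simp add: cong_def)
  qed
  note T = G(2-5)[OF pq(3,4)]
  show "(t (fst p) (fst q), (2 * c - snd p - snd q) mod c) \<in> X \<times> {..<c}"
    using T d pq by auto
  show "g (fst (t (fst p) (fst q), (2 * c - snd p - snd q) mod c)) \<noteq> g (fst p)"
    using T d pq by auto
  show "(t (fst q) (fst p), (2 * c - snd q - snd p) mod c) =
      (t (fst p) (fst q), (2 * c - snd p - snd q) mod c)"
    using T d pq by (auto simp: add.commute)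
  show "(t (fst p) (fst (t (fst p) (fst q), (2 * c - snd p - snd q) mod c)),
      (2 * c - snd p - snd (t (fst p) (fst q), (2 * c - snd p - snd q) mod c)) mod c) = q"
    using T d pq ij[OF pq(5,6)] by auto
qed

lemma deficiency_order_weighted_gdd:
  assumes gdd: "gdd_op X g t"
    and groups: "\<And>i. i \<in> g ` X \<Longrightarrow> card {x \<in> X. g x = i} * c = v"
    and v: "deficiency_order w v"
  shows "deficiency_order w (card X * c)"
proof -
  have "deficiency_order w (card (X \<times> {..<c}))"
  proof (rule deficiency_order_gdd[OF gdd_op_weight[OF gdd]])
    fix i assume i: "i \<in> (\<lambda>p. g (fst p)) ` (X \<times> {..<c})"
    have "{p \<in> X \<times> {..<c}. g (fst p) = i} = {x \<in> X. g x = i} \<times> {..<c}" by auto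
    then show "deficiency_order w (card {p \<in> X \<times> {..<c}. g (fst p) = i})"
      using groups[of i] i v by (auto simp: card_cartesian_product)
  qed
  then show ?thesis by (simp add: card_cartesian_product)
qed

lemma gdd_op_three_points: "gdd_op {..<3::nat} id (\<lambda>i j. 3 - i - j)"
  unfolding gdd_op_def by (intro conjI ballI impI; simp; arith)

lemma deficiency_order_triple:
  assumes "deficiency_order w v"
  shows "deficiency_order w (3 * v)"
proof -
  have "{x \<in> {..<3::nat}. id x = i} = {i}" if "i < 3" for i using that by auto
  then have "deficiency_order w (card {..<3::nat} * v)"
    using assms by (intro deficiency_order_weighted_gdd[OF gdd_op_three_points]) auto
  then show ?thesis by simp
qed

text \<open>
  Deleting a point \<open>p\<close> from a Steiner triple system (a design whose groups are single
  points) turns the blocks through \<open>p\<close> into groups of size two. The group of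
  \<open>x\<close> is named by the pair \<open>{x, t p x}\<close>.
\<close>
lemma gdd_op_delete_point:
  assumes gdd: "gdd_op X id t" and p: "p \<in> X"
  shows "gdd_op (X - {p}) (\<lambda>x. {x, t p x}) t"
    and "x \<in> X - {p} \<Longrightarrow> card {y \<in> X - {p}. {y, t p y} = {x, t p x}} = 2"
proof -
  note G = gdd_opD[OF gdd, unfolded id_apply]
  have px: "t p x \<in> X" "t p x \<noteq> p" "t p x \<noteq> x" "t p (t p x) = x" "t x p = t p x"
    if "x \<in> X - {p}" for x
    using G(2,3,5)[of p x] G(3)[of x p] G(4)[of p x] that p by auto
  show "gdd_op (X - {p}) (\<lambda>x. {x, t p x}) t"
    unfolding gdd_op_def
  proof (intro conjI ballI impI)
    show "finite (X - {p})" using G(1) by simp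
    fix x y assume xy: "x \<in> X - {p}" "y \<in> X - {p}" "{x, t p x} \<noteq> {y, t p y}"
    then have ne: "x \<noteq> y" by auto
    have h: "x \<in> X" "y \<in> X" using xy by auto
    note T = G(2-5)[OF h ne]
    have tp: "t x y \<noteq> p"
    proof
      assume "t x y = p"
      then have "t p x = y" using T(4) px[OF xy(1)] by simp
      then show False using xy(3) px[OF xy(1)] by auto
    qed
    show "t x y \<in> X - {p}" using T tp by simp
    have "t x y \<noteq> t p x"
    proof
      assume "t x y = t p x"
      then have "y = t x (t x p)" using T(4) px(5)[OF xy(1)] by simp
      also have "\<dots> = p" using G(5)[of x p] xy p by simp
      finally show False using xy by simp
    qed
    then show "{t x y, t p (t x y)} \<noteq> {x, t p x}" using T(2) by blast
    show "t y x = t x y" "t x (t x y) = y" using T by auto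
  qed
  show "card {y \<in> X - {p}. {y, t p y} = {x, t p x}} = 2" if x: "x \<in> X - {p}"
  proof -
    have "{y \<in> X - {p}. {y, t p y} = {x, t p x}} = {x, t p x}"
      using x px[OF x] by (auto simp: doubleton_eq_iff)
    then show ?thesis using px(3)[OF x] by auto
  qed
qed

text \<open>
  Bose's Steiner triple system on the integers modulo \<open>2k + 1\<close> times the integers modulo 3.
  Its blocks are \<open>{(x,0), (x,1), (x,2)}\<close> and \<open>{(x,i), (y,i), ((x + y)/2, i +
  1)}\<close>; halving modulo \<open>2k + 1\<close> is multiplication by \<open>k + 1\<close>.
\<close>
definition bose_op :: "int \<Rightarrow> int \<times> int \<Rightarrow> int \<times> int \<Rightarrow> int \<times> int" where
  "bose_op k = (\<lambda>(x, i) (y, j).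
     if i = j then (((k + 1) * (x + y)) mod (2 * k + 1), (i + 1) mod 3)
     else if x = y then (x, (- i - j) mod 3)
     else if j = (i + 1) mod 3 then ((2 * y - x) mod (2 * k + 1), i)
     else ((2 * x - y) mod (2 * k + 1), j))"

lemma mod_odd_half:
  fixes k m x y z :: int
  assumes m: "m = 2 * k + 1"
  shows "(2 * (((k + 1) * (x + y)) mod m) - x) mod m = y mod m"
    and "((k + 1) * (x + (2 * y - x) mod m)) mod m = y mod m"
proof -
  have "(2 * (((k + 1) * (x + y)) mod m) - x) mod m = (2 * ((k + 1) * (x + y)) - x) mod m"
    by (subst (1 2) mod_diff_left_eq[symmetric]) (simp only: mod_mult_right_eq)
  also have "2 * ((k + 1) * (x + y)) - x = y + m * (x + y)" by (simp add: m algebra_simps)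
  finally show "(2 * (((k + 1) * (x + y)) mod m) - x) mod m = y mod m" by simp
  have "((k + 1) * (x + (2 * y - x) mod m)) mod m = ((k + 1) * (x + (2 * y - x))) mod m"
    by (metis mod_add_right_eq mod_mult_right_eq)
  also have "(k + 1) * (x + (2 * y - x)) = y + m * y" by (simp add: m algebra_simps)
  finally show "((k + 1) * (x + (2 * y - x) mod m)) mod m = y mod m" by simp
qed

lemma gdd_op_bose:
  fixes k :: int
  assumes k: "0 \<le> k"
  shows "gdd_op ({0..<2 * k + 1} \<times> {0..<3}) id (bose_op k)"
  unfolding gdd_op_def id_apply
proof (intro conjI ballI impI)
  define m where "m = 2 * k + 1"
  have m: "0 < m" using k by (simp add: m_def)
  show "finite ({0..<2 * k + 1} \<times> {0..<3::int})" by simp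
  fix p q assume "p \<in> {0..<2 * k + 1} \<times> {0..<3::int}" "q \<in> {0..<2 * k + 1} \<times> {0..<3::int}" "p \<noteq> q"
  then obtain x i y j where pq: "p = (x, i)" "q = (y, j)" "0 \<le> x" "x < m" "0 \<le> y" "y < m"
      "0 \<le> i" "i < 3" "0 \<le> j" "j < 3" and ne: "(x, i) \<noteq> (y, j)"
    by (cases p; cases q) (auto simp: m_def)
  have bose: "bose_op k (x, i) (y, j) =
     (if i = j then (((k + 1) * (x + y)) mod m, (i + 1) mod 3)
     else if x = y then (x, (- i - j) mod 3)
     else if j = (i + 1) mod 3 then ((2 * y - x) mod m, i)
     else ((2 * x - y) mod m, j))" for x i y j
    by (simp add: bose_op_def m_def)
  note half = mod_odd_half[OF m_def]
  have h1: "(2 * (((k + 1) * (x + y)) mod m) - x) mod m = y" using half(1)[of x y] pq by simp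
  have h2: "((k + 1) * (x + (2 * y - x) mod m)) mod m = y" using half(2)[of x y] pq by simp
  have h3: "((k + 1) * (x + y)) mod m \<noteq> x" if "x \<noteq> y" using h1 that pq by auto
  have h4: "(2 * y - x) mod m \<noteq> x" if "x \<noteq> y"
  proof
    assume "(2 * y - x) mod m = x"
    then have "((k + 1) * (x + x)) mod m = y" using h2 by simp
    moreover have "((k + 1) * (x + x)) mod m = x" using half(2)[of x x] pq by simp
    ultimately show False using that by simp
  qed
  have h5: "(2 * x - (2 * x - y) mod m) mod m = y" using pq by (simp add: mod_simps)
  have h6: "(2 * x - y) mod m \<noteq> x" if "x \<noteq> y" using h5 that pq by auto
  have h6': "x \<noteq> (2 * x - y) mod m" if "x \<noteq> y" using h6 that by metis
  have h3': "x \<noteq> ((k + 1) * (x + y)) mod m" if "x \<noteq> y" using h3 that by metis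
  have ij: "i = 0 \<or> i = 1 \<or> i = 2" "j = 0 \<or> j = 1 \<or> j = 2" using pq by auto
  have bnd: "0 \<le> a mod m" "a mod m < m" for a using m by auto
  show "bose_op k p q \<in> {0..<2 * k + 1} \<times> {0..<3}"
    using pq bnd by (auto simp: bose simp flip: m_def)
  have ni: "(i + 1) mod 3 \<noteq> i" "i \<noteq> (i + 1) mod 3" using ij(1) by auto
  consider (a) "i = j" "x \<noteq> y" | (b) "x = y" "i \<noteq> j"
    | (c) "x \<noteq> y" "i \<noteq> j" "j = (i + 1) mod 3" "i \<noteq> (j + 1) mod 3"
    | (d) "x \<noteq> y" "i \<noteq> j" "j \<noteq> (i + 1) mod 3" "i = (j + 1) mod 3"
    using ne ij by (elim disjE) auto
  then have "bose_op k (x, i) (y, j) \<noteq> (x, i) \<and> bose_op k (y, j) (x, i) = bose_op k (x, i) (y, j) \<and>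
      bose_op k (x, i) (bose_op k (x, i) (y, j)) = (y, j)"
  proof cases
    case a
    then show ?thesis using h1 h3'[OF a(2)] ni by (simp add: bose add.commute)
  next
    case b
    have "(- i - j) mod 3 \<noteq> i" "i \<noteq> (- i - j) mod 3" "(- i - (- i - j) mod 3) mod 3 = j"
      using ij b(2) by (elim disjE; simp)+
    then show ?thesis using b by (simp add: bose minus_diff_commute)
  next
    case c
    then show ?thesis using h2 h4[OF c(1)] by (simp add: bose)
  next
    case d
    then show ?thesis using h5 h6[OF d(1)] h6'[OF d(1)] by (simp add: bose)
  qed
  then show "bose_op k p q \<noteq> p" "bose_op k q p = bose_op k p q" "bose_op k p (bose_op k p q) = q"
    by (simp_all add: pq(1,2))
qed

lemma deficiency_order_times_1_mod_3:
  assumes v: "deficiency_order w (2 * v)" and u: "u mod 3 = 1"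
  shows "deficiency_order w (2 * (u * v))"
proof -
  have k: "u = 3 * (u div 3) + 1" using u by presburger
  define k where "k = u div 3"
  note k = k[folded k_def]
  let ?X = "{0..<2 * int k + 1} \<times> {0..<3::int}"
  have p: "(0, 0) \<in> ?X" by simp
  note d = gdd_op_delete_point[OF gdd_op_bose[OF of_nat_0_le_iff[of k]] p]
  have "card (?X - {(0, 0)}) = card ?X - 1"
    by (rule card_Diff_singleton) (use p in blast)
  also have "\<dots> = 2 * u"
    by (simp add: card_cartesian_product k nat_add_distrib nat_mult_distrib)
  finally have c: "card (?X - {(0, 0)}) = 2 * u" .
  have "deficiency_order w (card (?X - {(0, 0)}) * v)"
  proof (rule deficiency_order_weighted_gdd[OF d(1) _ v])
    fix i assume "i \<in> (\<lambda>x. {x, bose_op (int k) (0, 0) x}) ` (?X - {(0, 0)})"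
    then obtain x where x: "x \<in> ?X - {(0, 0)}" and i: "i = {x, bose_op (int k) (0, 0) x}" by blast
    show "card {y \<in> ?X - {(0, 0)}. {y, bose_op (int k) (0, 0) y} = i} * v = 2 * v"
      unfolding i using d(2)[OF x] by (rule arg_cong)
  qed
  then show ?thesis by (simp only: c mult.assoc)
qed

text \<open>
  Wilson's fundamental construction. \<open>\<Lambda>\<close> is a set of lines of a design on
  \<open>X\<close> whose points are pairs of a group and a coordinate; the line \<open>l\<close> meets
  the groups in \<open>K l\<close>, each in the point with coordinate \<open>pt l g\<close>, and
  \<open>J\<close> joins two points of different groups. Each point is replaced by copies indexed by
  \<open>I\<close>, and each line by a design with blocks of size three on its own points. Lines may
  have different sizes.
\<close>
lemma gdd_op_wilson:
  fixes pt :: "'l \<Rightarrow> 'g \<Rightarrow> 'c"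
  assumes X: "finite X" and I: "finite I"
    and line_pts: "\<And>l g. l \<in> \<Lambda> \<Longrightarrow> g \<in> K l \<Longrightarrow> (g, pt l g) \<in> X"
    and joins: "\<And>p q. p \<in> X \<Longrightarrow> q \<in> X \<Longrightarrow> fst p \<noteq> fst q \<Longrightarrow> J p q \<in> \<Lambda> \<and>
        fst p \<in> K (J p q) \<and> fst q \<in> K (J p q) \<and> pt (J p q) (fst p) = snd p \<and> pt (J p q) (fst q) = snd q"
    and unique: "\<And>l g h. l \<in> \<Lambda> \<Longrightarrow> g \<in> K l \<Longrightarrow> h \<in> K l \<Longrightarrow> g \<noteq> h \<Longrightarrow> J (g, pt l g) (h, pt l h) = l"
    and op: "\<And>l. l \<in> \<Lambda> \<Longrightarrow> gdd_op (K l \<times> I) fst (u l)"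
  shows "gdd_op (X \<times> I) (\<lambda>z. fst (fst z))
     (\<lambda>(p, a) (q, b). let l = J p q; r = u l (fst p, a) (fst q, b) in ((fst r, pt l (fst r)), snd r))"
    (is "gdd_op _ _ ?t")
  unfolding gdd_op_def
proof (intro conjI ballI impI)
  show "finite (X \<times> I)" using X I by simp
  fix z z' assume "z \<in> X \<times> I" "z' \<in> X \<times> I" and ne: "fst (fst z) \<noteq> fst (fst z')"
  then obtain g c a h d b where z: "z = ((g, c), a)" "z' = ((h, d), b)"
      and in_X: "(g, c) \<in> X" "(h, d) \<in> X" and ab: "a \<in> I" "b \<in> I" by auto
  have gh: "g \<noteq> h" using ne z by simp
  define l where "l = J (g, c) (h, d)"
  have l: "l \<in> \<Lambda>" "g \<in> K l" "h \<in> K l" "pt l g = c" "pt l h = d"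
    using joins[OF in_X] gh by (auto simp: l_def)
  have l': "J (h, d) (g, c) = l" using unique[OF l(1,3,2)] gh l by auto
  define r where "r = u l (g, a) (h, b)"
  have m: "(g, a) \<in> K l \<times> I" "(h, b) \<in> K l \<times> I" "fst (g, a) \<noteq> fst (h, b)" using l ab gh by auto
  note U = gdd_opD(2-5)[OF op[OF l(1)] m]
  have r: "fst r \<in> K l" "snd r \<in> I" "fst r \<noteq> g" "u l (h, b) (g, a) = r" "u l (g, a) r = (h, b)"
    using U unfolding r_def by auto
  have t: "?t z z' = ((fst r, pt l (fst r)), snd r)"
    by (simp add: z Let_def flip: l_def r_def)
  show "?t z z' \<in> X \<times> I" using t r line_pts[OF l(1) r(1)] by simp
  show "fst (fst (?t z z')) \<noteq> fst (fst z)" using t r z by simp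
  show "?t z' z = ?t z z'" unfolding t using r(4) by (simp add: z Let_def l')
  have "J (g, c) (fst r, pt l (fst r)) = l" using unique[OF l(1,2) r(1)] r(3) l by auto
  then show "?t z (?t z z') = z'" unfolding t using r(5) l by (simp add: z Let_def)
qed

text \<open>
  The transversal design with four groups of size \<open>n\<close>, \<open>n\<close> odd, that comes
  from the two orthogonal Latin squares \<open>b + a\<close> and \<open>b - a\<close>: the line
  \<open>(b, a)\<close> meets the four groups in the coordinates \<open>b\<close>, \<open>b + a\<close>,
  \<open>b - a\<close>, \<open>a\<close>.
\<close>
definition td_point :: "int \<Rightarrow> int \<times> int \<Rightarrow> nat \<Rightarrow> int" where
  "td_point n l g = (case l of (b, a) \<Rightarrow>
     if g = 0 then b else if g = 1 then (b + a) mod n else if g = 2 then (b - a) mod n else a)"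

text \<open>
  The line through the points with coordinates \<open>x\<close> and \<open>y\<close> in the groups
  \<open>g < h\<close>, obtained by solving for \<open>b\<close> and \<open>a\<close>. In the groups 1
  and 2 this divides by two, that is, multiplies by \<open>k + 1\<close> modulo \<open>2k + 1\<close>.
\<close>
definition td_line :: "int \<Rightarrow> nat \<Rightarrow> int \<Rightarrow> nat \<Rightarrow> int \<Rightarrow> int \<times> int" where
  "td_line k g x h y =
     (if g = 0 then (x, if h = 1 then (y - x) mod (2 * k + 1) else if h = 2 then (x - y) mod (2 * k + 1) else y)
      else if h = 2 then (((k + 1) * (x + y)) mod (2 * k + 1), ((k + 1) * (x - y)) mod (2 * k + 1))
      else ((if g = 1 then x - y else x + y) mod (2 * k + 1), y))"

lemma td_line_point:
  assumes n: "n = 2 * k + 1" and ba: "0 \<le> b" "b < n" "0 \<le> a" "a < n" and gh: "g < h" "h < 4"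
  shows "td_line k g (td_point n (b, a) g) h (td_point n (b, a) h) = (b, a)"
proof -
  have half: "((k + 1) * ((b + a) mod n + (b - a) mod n)) mod n = b"
     "((k + 1) * ((b + a) mod n - (b - a) mod n)) mod n = a"
  proof -
    have "((k + 1) * ((b + a) mod n + (b - a) mod n)) mod n = ((k + 1) * ((b + a) + (b - a))) mod n"
      by (metis mod_add_eq mod_mult_right_eq)
    also have "(k + 1) * ((b + a) + (b - a)) = b + n * b" by (simp add: n algebra_simps)
    finally show "((k + 1) * ((b + a) mod n + (b - a) mod n)) mod n = b" using ba by simp
    have "((k + 1) * ((b + a) mod n - (b - a) mod n)) mod n = ((k + 1) * ((b + a) - (b - a))) mod n"
      by (metis mod_diff_eq mod_mult_right_eq)
    also have "(k + 1) * ((b + a) - (b - a)) = a + n * a" by (simp add: n algebra_simps)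
    finally show "((k + 1) * ((b + a) mod n - (b - a) mod n)) mod n = a" using ba by simp
  qed
  have step: "((b + a) mod n - b) mod n = a" "(b - (b - a) mod n) mod n = a"
    "((b + a) mod n - a) mod n = b" "((b - a) mod n + a) mod n = b"
    using ba by (simp_all add: mod_simps)
  consider "g = 0" "h = 1" | "g = 0" "h = 2" | "g = 0" "h = 3" | "g = 1" "h = 2" | "g = 1" "h = 3"
    | "g = 2" "h = 3" using gh by linarith
  then show ?thesis
    by cases (simp_all add: td_line_def td_point_def half step flip: n)
qed

text \<open>
  Existence of the joining line; \<open>td_line_point\<close> is its uniqueness, as every line through
  two given points is recovered from them.
\<close>
lemma td_point_line:
  assumes n: "n = 2 * k + 1" and xy: "0 \<le> x" "x < n" "0 \<le> y" "y < n" and gh: "g < h" "h < 4"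
  shows "td_line k g x h y \<in> {0..<n} \<times> {0..<n} \<and>
     td_point n (td_line k g x h y) g = x \<and> td_point n (td_line k g x h y) h = y"
proof -
  have half: "((k + 1) * (x + y) mod n + (k + 1) * (x - y) mod n) mod n = x"
     "((k + 1) * (x + y) mod n - (k + 1) * (x - y) mod n) mod n = y"
  proof -
    have "(k + 1) * (x + y) + (k + 1) * (x - y) = x + n * x"
         "(k + 1) * (x + y) - (k + 1) * (x - y) = y + n * y" by (simp_all add: n algebra_simps)
    then show "((k + 1) * (x + y) mod n + (k + 1) * (x - y) mod n) mod n = x"
     "((k + 1) * (x + y) mod n - (k + 1) * (x - y) mod n) mod n = y"
      using xy unfolding mod_add_eq mod_diff_eq by simp_all
  qed
  have step: "(x + (y - x) mod n) mod n = y" "(x - (x - y) mod n) mod n = y"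
     "((x - y) mod n + y) mod n = x" "((x + y) mod n - y) mod n = x"
    using xy by (simp_all add: mod_simps)
  have bnd: "0 \<le> c mod n" "c mod n < n" for c using xy by auto
  consider "g = 0" "h = 1" | "g = 0" "h = 2" | "g = 0" "h = 3" | "g = 1" "h = 2" | "g = 1" "h = 3"
    | "g = 2" "h = 3" using gh by linarith
  then show ?thesis
    by cases (simp_all add: td_line_def td_point_def half step bnd xy flip: n)
qed

definition td_join :: "int \<Rightarrow> nat \<times> int \<Rightarrow> nat \<times> int \<Rightarrow> int \<times> int" where
  "td_join k p q = (if fst p < fst q then td_line k (fst p) (snd p) (fst q) (snd q)
     else td_line k (fst q) (snd q) (fst p) (snd p))"

lemma td_join_point:
  assumes "n = 2 * k + 1" "l \<in> {0..<n} \<times> {0..<n}" "g < 4" "h < 4" "g \<noteq> h"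
  shows "td_join k (g, td_point n l g) (h, td_point n l h) = l"
  using assms td_line_point[of n k "fst l" "snd l" g h] td_line_point[of n k "fst l" "snd l" h g]
  by (auto simp: td_join_def)

lemma td_point_join:
  assumes "n = 2 * k + 1" "0 \<le> snd p" "snd p < n" "fst p < 4" "0 \<le> snd q" "snd q < n" "fst q < 4"
    and "fst p \<noteq> fst q"
  shows "td_join k p q \<in> {0..<n} \<times> {0..<n}"
    and "td_point n (td_join k p q) (fst p) = snd p"
    and "td_point n (td_join k p q) (fst q) = snd q"
  using assms td_point_line[of n k "snd p" "snd q" "fst p" "fst q"]
    td_point_line[of n k "snd q" "snd p" "fst q" "fst p"]
  by (auto simp: td_join_def)

text \<open>
  Four groups of size two. The points are the nonzero vectors of the plane over the field with three
  elements, the groups are the pairs \<open>{v, -v}\<close>, and the blocks are the affine lines that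
  avoid the origin.
\<close>
definition gdd_2_4_blocks :: "(nat \<times> nat) list list" where
  "gdd_2_4_blocks = [[(0,0),(1,0),(2,1)], [(0,1),(1,1),(2,0)], [(0,0),(1,1),(3,1)], [(0,1),(1,0),(3,0)],
     [(0,0),(2,0),(3,0)], [(0,1),(2,1),(3,1)], [(1,0),(2,0),(3,1)], [(1,1),(2,1),(3,0)]]"

definition gdd_2_4_op :: "nat \<times> nat \<Rightarrow> nat \<times> nat \<Rightarrow> nat \<times> nat" where
  "gdd_2_4_op p q = hd (removeAll p (removeAll q (hd (filter (\<lambda>b. p \<in> set b \<and> q \<in> set b) gdd_2_4_blocks))))"

lemma gdd_op_2_4: "gdd_op ({..<4} \<times> {..<2}) fst gdd_2_4_op"
proof -
  have "\<forall>p\<in>set (List.product [0..<4] [0..<2]). \<forall>q\<in>set (List.product [0..<4] [0..<2]). fst p \<noteq> fst q \<longrightarrow>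
     gdd_2_4_op p q \<in> set (List.product [0..<4] [0..<2]) \<and> fst (gdd_2_4_op p q) \<noteq> fst p \<and>
     gdd_2_4_op q p = gdd_2_4_op p q \<and> gdd_2_4_op p (gdd_2_4_op p q) = q"
    by code_simp
  moreover have "{..<4} \<times> {..<2} = set (List.product [0..<4] [0..<2::nat])" by auto
  ultimately show ?thesis unfolding gdd_op_def by simp
qed

lemma gdd_op_2_3: "\<exists>t. gdd_op ({..<3::nat} \<times> {..<2::nat}) fst t"
  using gdd_op_weight[OF gdd_op_three_points, of 2] by auto

text \<open>
  The fourth group of the transversal design is cut down to \<open>s\<close> points, which leaves lines
  of sizes three and four. Every point is doubled, and the lines are replaced by designs with three and
  four groups of size two.
\<close>
lemma deficiency_order_truncated_td:
  assumes n: "odd n" and s: "s \<le> n"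
    and dn: "deficiency_order w (2 * n)" and ds: "deficiency_order w (2 * s)"
  shows "deficiency_order w (2 * (3 * n + s))"
proof -
  obtain k where k: "n = 2 * k + 1" using n by (auto elim: oddE)
  define N where "N = int n"
  have N: "N = 2 * int k + 1" by (simp add: N_def k)
  define X where "X = {..<3::nat} \<times> {0..<N} \<union> {3} \<times> {0..<int s}"
  define K where "K l = (if snd l < int s then {..<4::nat} else {..<3})" for l :: "int \<times> int"
  obtain u3 where u3: "gdd_op ({..<3::nat} \<times> {..<2::nat}) fst u3" using gdd_op_2_3 by blast
  define u where "u l = (if snd l < int s then gdd_2_4_op else u3)" for l :: "int \<times> int"
  have sN: "int s \<le> N" using s by (simp add: N_def)
  have X4: "fst p < 4 \<and> 0 \<le> snd p \<and> snd p < N \<and> (fst p = 3 \<longrightarrow> snd p < int s)" if "p \<in> X" for p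
    using that sN by (auto simp: X_def)
  have gdd: "gdd_op (X \<times> {..<2::nat}) (\<lambda>z. fst (fst z))
     (\<lambda>(p, a) (q, b). let l = td_join (int k) p q; r = u l (fst p, a) (fst q, b)
        in ((fst r, td_point N l (fst r)), snd r))"
  proof (rule gdd_op_wilson[where \<Lambda> = "{0..<N} \<times> {0..<N}" and K = K])
    show "finite X" by (simp add: X_def)
    fix l g assume l: "l \<in> {0..<N} \<times> {0..<N}" and g: "g \<in> K l"
    obtain b a where ba: "l = (b, a)" "0 \<le> b" "b < N" "0 \<le> a" "a < N" using l by auto
    show "(g, td_point N l g) \<in> X" using g ba by (auto simp: X_def K_def td_point_def split: if_splits)
    fix h assume "h \<in> K l" "g \<noteq> h"
    then show "td_join (int k) (g, td_point N l g) (h, td_point N l h) = l"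
      using g l by (intro td_join_point[OF N]) (auto simp: K_def split: if_splits)
  next
    fix p q assume pq: "p \<in> X" "q \<in> X" "fst p \<noteq> fst q"
    note P = X4[OF pq(1)] and Q = X4[OF pq(2)]
    define l where "l = td_join (int k) p q"
    have l: "l \<in> {0..<N} \<times> {0..<N}" "td_point N l (fst p) = snd p" "td_point N l (fst q) = snd q"
      unfolding l_def using P Q pq(3) by (intro td_point_join[OF N]; simp)+
    have 3: "td_point N l 3 = snd l" by (cases l) (simp add: td_point_def)
    have "fst p \<in> K l" using P l(2) 3 unfolding K_def by (cases "fst p = 3") auto
    moreover have "fst q \<in> K l" using Q l(3) 3 unfolding K_def by (cases "fst q = 3") auto
    ultimately show "td_join (int k) p q \<in> {0..<N} \<times> {0..<N} \<and> fst p \<in> K (td_join (int k) p q) \<and>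
        fst q \<in> K (td_join (int k) p q) \<and> td_point N (td_join (int k) p q) (fst p) = snd p \<and>
        td_point N (td_join (int k) p q) (fst q) = snd q" using l by (simp add: l_def)
  next
    show "gdd_op (K l \<times> {..<2}) fst (u l)" for l
      using gdd_op_2_4 u3 by (simp add: K_def u_def)
  qed simp
  have "deficiency_order w (card (X \<times> {..<2::nat}))"
  proof (rule deficiency_order_gdd[OF gdd])
    fix i assume i: "i \<in> (\<lambda>z. fst (fst z)) ` (X \<times> {..<2::nat})"
    have "{z \<in> X \<times> {..<2::nat}. fst (fst z) = i} = {p \<in> X. fst p = i} \<times> {..<2}" by auto
    moreover have "{p \<in> X. fst p = i} = (if i = 3 then {3} \<times> {0..<int s} else {i} \<times> {0..<N})"
      using i by (auto simp: X_def)
    ultimately show "deficiency_order w (card {z \<in> X \<times> {..<2::nat}. fst (fst z) = i})"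
      using dn ds by (simp add: card_cartesian_product N_def mult.commute)
  qed
  moreover have "card X = 3 * n + s"
  proof -
    have "card X = card ({..<3::nat} \<times> {0..<N}) + card ({3::nat} \<times> {0..<int s})"
      unfolding X_def by (rule card_Un_disjoint) auto
    then show ?thesis by (simp add: card_cartesian_product N_def)
  qed
  ultimately show ?thesis by (simp add: card_cartesian_product mult.commute)
qed

section \<open>Orders generated by two coprime orders\<close>

text \<open>
  Multiplier 3 turns \<open>1\<close> modulo 3 into \<open>3\<close> modulo 9. For \<open>6\<close>
  modulo 9, write the multiplier as \<open>3i + 3j\<close> with \<open>i \<equiv> j \<equiv> 1\<close>
  modulo 3 and \<open>i\<close> odd; this is the truncated transversal design with \<open>i b\<close>
  and \<open>3 j b\<close>, which needs \<open>3j \<le> i\<close> and hence the lower bound on the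
  multiplier.
\<close>
lemma deficiency_order_times_3_6_mod_9:
  assumes b: "deficiency_order w (2 * b)" "odd b" and u: "u mod 9 = 3 \<or> u mod 9 = 6 \<and> 54 \<le> u"
  shows "deficiency_order w (2 * (u * b))"
  using u
proof (elim disjE conjE)
  assume "u mod 9 = 3"
  then have "u = 3 * (u div 3)" "u div 3 mod 3 = 1" by presburger+
  moreover have "deficiency_order w (3 * (2 * (u div 3 * b)))"
    by (intro deficiency_order_triple deficiency_order_times_1_mod_3 b calculation)
  ultimately show ?thesis by (simp add: mult_ac)
next
  assume "u mod 9 = 6" "54 \<le> u"
  define k where "k = u div 9"
  define m s where "m = k div 2" and "s = k mod 2"
  define i j where "i = 6 * m + 1" and "j = 3 * s + 1"
  have "u = 9 * k + 6" using \<open>u mod 9 = 6\<close> mult_div_mod_eq[of 9 u] by (simp add: k_def)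
  moreover have "k = 2 * m + s" "s < 2" by (simp_all add: m_def s_def)
  ultimately have uij: "u = 3 * i + 3 * j" and "3 * j \<le> i"
    using \<open>54 \<le> u\<close> by (simp_all add: i_def j_def)
  moreover have "i mod 3 = 1" "j mod 3 = 1" "odd i" unfolding i_def j_def by presburger+
  ultimately have ij: "i mod 3 = 1" "j mod 3 = 1" "odd i" "3 * j \<le> i" by blast+
  have "deficiency_order w (2 * (3 * (i * b) + 3 * (j * b)))"
  proof (rule deficiency_order_truncated_td)
    show "odd (i * b)" using ij b by simp
    show "3 * (j * b) \<le> i * b" using mult_le_mono1[OF ij(4), of b] by simp
    show "deficiency_order w (2 * (i * b))"
      by (intro deficiency_order_times_1_mod_3 b ij)
    have "deficiency_order w (3 * (2 * (j * b)))"
      by (intro deficiency_order_triple deficiency_order_times_1_mod_3 b ij)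
    then show "deficiency_order w (2 * (3 * (j * b)))" by (simp add: mult_ac)
  qed
  then show ?thesis by (simp add: uij algebra_simps)
qed

text \<open>
  A solution \<open>u\<close> of \<open>b u \<equiv> V - c\<close> modulo \<open>M\<close> in a
  prescribed interval of length \<open>M\<close>; the lower end \<open>L\<close> is there because some
  multipliers are only available from some point on.
\<close>
lemma solve_linear_remainder:
  fixes a b M V :: nat
  assumes "coprime b M" "0 < M" "c + b * (L + M) \<le> V"
  obtains u q where "L \<le> u" "u < L + M" "V = b * u + (c + M * q)"
proof -
  obtain x where x: "[b * x = 1] (mod M)" using cong_solve_coprime_nat[OF assms(1)] by auto
  \<comment> \<open>\<open>M - 1\<close> plays the role of \<open>-1\<close> modulo \<open>M\<close>.\<close>
  define z where "z = x * ((V - c) + (M - 1) * (b * L))"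
  define u where "u = L + z mod M"
  have "[b * z = 1 * ((V - c) + (M - 1) * (b * L))] (mod M)"
    using cong_mult[OF x cong_refl[of "(V - c) + (M - 1) * (b * L)"]] by (simp add: z_def mult.assoc)
  then have "[b * L + b * (z mod M) = b * L + ((V - c) + (M - 1) * (b * L))] (mod M)"
    by (intro cong_add cong_refl) (simp add: cong_def mod_simps)
  also have "b * L + ((V - c) + (M - 1) * (b * L)) = (V - c) + M * (b * L)"
    using assms(2) by (cases M) (auto simp: algebra_simps)
  also have "[(V - c) + M * (b * L) = V - c] (mod M)" by (simp add: cong_def)
  finally have "[b * u = V - c] (mod M)" by (simp add: u_def distrib_left)
  moreover have uM: "u < L + M" using assms(2) by (simp add: u_def)
  then have "b * u \<le> V - c" using assms(3) mult_le_mono2[of u "L + M" b] by linarith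
  ultimately have "M dvd V - c - b * u"
    using mod_eq_dvd_iff_nat[of "b * u" "V - c" M] by (simp add: cong_def eq_commute)
  then obtain q where "V - c - b * u = M * q" by blast
  then have "V = b * u + (c + M * q)" using \<open>b * u \<le> V - c\<close> assms(3) by linarith
  moreover have "L \<le> u" by (simp add: u_def)
  ultimately show thesis using that uM by blast
qed

text \<open>
  Write \<open>V = 3 s a + u b\<close> with \<open>s\<close> odd, \<open>u b \<le> s a\<close>, and
  admissible multipliers \<open>s\<close> and \<open>u\<close>. Fixing \<open>s\<close> modulo 6 (or 18)
  prescribes \<open>u\<close> modulo \<open>18 a\<close> (or \<open>54 a\<close>), so \<open>u\<close>
  is bounded while \<open>s\<close> grows with \<open>V\<close>. With \<open>s \<equiv> 1\<close> modulo
  6 the residue of \<open>V\<close> forces \<open>u \<equiv> 1\<close> modulo 3 or \<open>3\<close>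
  divides \<open>u\<close>; \<open>u \<equiv> 0\<close> modulo 9, for which there is no multiplier at
  hand, occurs exactly when \<open>V \<equiv> 3a\<close> modulo 9. In that case \<open>s \<equiv>
  3\<close> modulo 18 is taken instead and \<open>u \<equiv> 3\<close> modulo 9 results.
\<close>
lemma deficiency_order_all_large:
  assumes a: "deficiency_order w (2 * a)" and b: "deficiency_order w (2 * b)"
    and cop: "coprime a 6" "coprime b 6" "coprime a b" and ab: "a mod 3 = b mod 3"
    and V: "432 * a * b + 9 * a \<le> V" "V mod 3 = 0 \<or> V mod 3 = a mod 3"
  shows "deficiency_order w (2 * V)"
proof -
  have co: "coprime a 2" "coprime a 3" "coprime b 2" "coprime b 3"
    using cop(1,2) coprime_mult_right_iff[of a 2 3] coprime_mult_right_iff[of b 2 3] by auto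
  have odd: "odd a" "odd b" using co by auto
  have a0: "0 < a" using odd by (auto intro: odd_pos)
  have "\<not> 3 dvd b" using coprime_common_divisor[OF co(4), of 3] by auto
  then have b3: "b mod 3 = 1 \<or> b mod 3 = 2" by presburger
  have co': "coprime b (18 * a)" "coprime b (54 * a)"
  proof -
    have "18 * a = 2 * (3 * (3 * a))" "54 * a = 2 * (3 * (3 * (3 * a)))" by simp_all
    then show "coprime b (18 * a)" "coprime b (54 * a)"
      using co cop(3) by (simp_all only: coprime_mult_right_iff coprime_commute[of b a])
  qed
  have M: "0 < 18 * a" "0 < 54 * a" using a0 by simp_all
  have step: "deficiency_order w (2 * V)"
    if "V = 3 * (s * a) + u * b" "u * b \<le> s * a" "odd s" "deficiency_order w (2 * (s * a))"
       "deficiency_order w (2 * (u * b))" for s u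
    using deficiency_order_truncated_td[of "s * a" "u * b" w] that odd by simp
  show ?thesis
  proof (cases "V mod 9 = (3 * a) mod 9")
    case False
    have V1: "3 * a + b * (54 * a + 18 * a) \<le> V" using V(1) by (simp add: algebra_simps)
    obtain u q where u: "54 * a \<le> u" "u < 54 * a + 18 * a" and Vq: "V = b * u + (3 * a + 18 * a * q)"
      by (rule solve_linear_remainder[OF co'(1) M(1) V1])
    show ?thesis
    proof (rule step[of "6 * q + 1" u])
      show "V = 3 * ((6 * q + 1) * a) + u * b" using Vq by (simp add: algebra_simps)
      have "b * u \<le> b * (72 * a)" by (rule mult_le_mono2) (use u in simp)
      also have "b * (72 * a) = 72 * (a * b)" by simp
      finally have "b * u \<le> 72 * (a * b)" .
      moreover have "432 * (a * b) + 9 * a \<le> V" using V(1) by (simp add: mult.assoc)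
      ultimately have "4 * (b * u) \<le> V" by linarith
      then show "u * b \<le> (6 * q + 1) * a" using Vq by (simp add: algebra_simps)
      show "deficiency_order w (2 * ((6 * q + 1) * a))"
        by (rule deficiency_order_times_1_mod_3[OF a]) presburger
      have "V = u * b + 3 * (a * (1 + 6 * q))" using Vq by (simp add: algebra_simps)
      then obtain c where "V = u * b + 3 * c" by blast
      then have "V mod 3 = (u mod 3 * (b mod 3)) mod 3" by (simp add: mod_mult_eq)
      moreover have "u mod 3 = 0 \<or> u mod 3 = 1 \<or> u mod 3 = 2" by presburger
      ultimately have "u mod 3 = 1 \<or> u mod 3 = 0" using V(2) b3 ab by auto
      then show "deficiency_order w (2 * (u * b))"
      proof
        assume "u mod 3 = 1"
        then show ?thesis by (rule deficiency_order_times_1_mod_3[OF b])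
      next
        assume u3: "u mod 3 = 0"
        have "u mod 9 \<noteq> 0"
        proof
          assume "u mod 9 = 0"
          then obtain k where "u = 9 * k" by (auto simp: dvd_eq_mod_eq_0[symmetric])
          then have "V = 3 * a + 9 * (k * b + 2 * (a * q))" using Vq by (simp add: algebra_simps)
          then obtain c where "V = 3 * a + 9 * c" by blast
          then show False using False by simp
        qed
        then have "u mod 9 = 3 \<or> u mod 9 = 6" using u3 by presburger
        moreover have "54 \<le> u" using u(1) a0 by linarith
        ultimately show ?thesis by (intro deficiency_order_times_3_6_mod_9 b odd) auto
      qed
    qed simp
  next
    case True
    have V1: "9 * a + b * (0 + 54 * a) \<le> V" using V(1) by (simp add: algebra_simps)
    obtain u q where u: "u < 0 + 54 * a" and Vq: "V = b * u + (9 * a + 54 * a * q)"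
      by (rule solve_linear_remainder[OF co'(2) M(2) V1])
    show ?thesis
    proof (rule step[of "3 * (6 * q + 1)" u])
      show "V = 3 * (3 * (6 * q + 1) * a) + u * b" using Vq by (simp add: algebra_simps)
      have "b * u \<le> b * (54 * a)" by (rule mult_le_mono2) (use u in simp)
      also have "b * (54 * a) = 54 * (a * b)" by simp
      finally have "b * u \<le> 54 * (a * b)" .
      moreover have "432 * (a * b) + 9 * a \<le> V" using V(1) by (simp add: mult.assoc)
      ultimately have "4 * (b * u) \<le> V" by linarith
      then show "u * b \<le> 3 * (6 * q + 1) * a" using Vq by (simp add: algebra_simps)
      have "deficiency_order w (3 * (2 * ((6 * q + 1) * a)))"
        by (intro deficiency_order_triple deficiency_order_times_1_mod_3 a) presburger
      then show "deficiency_order w (2 * (3 * (6 * q + 1) * a))" by (simp add: algebra_simps)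
      have "V = b * u + 9 * (a + 6 * (a * q))" using Vq by (simp add: algebra_simps)
      then obtain c where "V = b * u + 9 * c" by blast
      then have "(b * u) mod 9 = V mod 9" by simp
      then have "(b mod 9 * (u mod 9)) mod 9 = (3 * a) mod 9" using True by (simp only: mod_mult_eq)
      also have "(3 * a) mod 9 = 3 * (a mod 3)" using mult_mod_right[of 3 a 3] by simp
      also have "a mod 3 = b mod 9 mod 3" using ab by (simp add: mod_mod_cancel)
      finally have *: "(b mod 9 * (u mod 9)) mod 9 = 3 * (b mod 9 mod 3)" .
      have "\<forall>s\<in>set [0..<9]. \<forall>t\<in>set [0..<9]. (s * t) mod 9 = 3 * (s mod 3) \<longrightarrow> s mod 3 \<noteq> 0 \<longrightarrow> t = 3"
        by code_simp
      moreover have "b mod 9 \<in> set [0..<9]" "u mod 9 \<in> set [0..<9]" by simp_all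
      moreover have "b mod 9 mod 3 \<noteq> 0" using b3 by (auto simp: mod_mod_cancel)
      ultimately have "u mod 9 = 3" using * by blast
      then show "deficiency_order w (2 * (u * b))"
        by (intro deficiency_order_times_3_6_mod_9 b odd) auto
    qed simp
  qed
qed

section \<open>Developing base triples modulo n\<close>

text \<open>
  A point \<open>(i, x)\<close> lies on side \<open>i\<close>, which is 0 or 1. Two ordered pairs of
  points are translates of each other modulo \<open>n\<close> iff their keys agree.
\<close>
definition diff_key :: "int \<Rightarrow> int \<times> int \<Rightarrow> int \<times> int \<Rightarrow> int \<times> int \<times> int" where
  "diff_key n A B = (fst A, fst B, (snd B - snd A) mod n)"

text \<open>
  \<open>(0, x)\<close> is joined to \<open>(1, x + d)\<close>; seen from side 1, \<open>(1, y)\<close>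
  is joined to \<open>(0, y - d)\<close>. The factor \<open>1 - 2 i\<close> is the sign \<open>1\<close>
  or \<open>-1\<close> that treats both sides at once.
\<close>
definition sidon_adj :: "int \<Rightarrow> int set \<Rightarrow> int \<times> int \<Rightarrow> int \<times> int \<Rightarrow> bool" where
  "sidon_adj n D p q \<longleftrightarrow> fst q = 1 - fst p \<and> (\<exists>d\<in>D. snd q = (snd p + (1 - 2 * fst p) * d) mod n)"

text \<open>
  \<open>Q\<close> is the set of base triples, in all orders of their points. The third point of the
  line through \<open>p\<close> and \<open>q\<close> is found by translating the unique base triple with
  the key of \<open>(p, q)\<close>. The assumption \<open>once\<close> gives more than unique lines: two
  2-paths of the graph with the same ends would be the same difference of \<open>D\<close> in two ways,
  hence the same base triple from \<open>blocks\<close>, so there are no 4-cycles.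
\<close>
lemma deficiency_op_develop:
  fixes n :: int and D :: "int set"
    and Q :: "((int \<times> int) \<times> (int \<times> int) \<times> (int \<times> int)) set"
  defines "P \<equiv> {0, 1} \<times> {0..<n}"
  assumes n: "0 < n"
    and D: "finite D" "inj_on (\<lambda>d. d mod n) D"
    and sym: "\<And>A B C. (A, B, C) \<in> Q \<Longrightarrow> (B, A, C) \<in> Q \<and> (A, C, B) \<in> Q"
    and sides: "\<And>A B C. (A, B, C) \<in> Q \<Longrightarrow> fst C \<in> {0, 1}"
    and once: "\<And>A B C A' B' C'. (A, B, C) \<in> Q \<Longrightarrow> (A', B', C') \<in> Q \<Longrightarrow>
        diff_key n A B = diff_key n A' B' \<Longrightarrow> (A, B, C) = (A', B', C')"
    and keys: "\<And>i k d. i \<in> {0, 1} \<Longrightarrow> k \<in> {0, 1} \<Longrightarrow> 0 \<le> d \<Longrightarrow> d < n \<Longrightarrow>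
        (\<exists>A B C. (A, B, C) \<in> Q \<and> diff_key n A B = (i, k, d)) \<longleftrightarrow>
        \<not> (k = i \<and> d = 0 \<or> k = 1 - i \<and> (\<exists>e\<in>D. d = ((1 - 2 * i) * e) mod n))"
    and blocks: "\<And>i d e. i \<in> {0, 1} \<Longrightarrow> d \<in> D \<Longrightarrow> e \<in> D \<Longrightarrow> d \<noteq> e \<Longrightarrow>
        \<exists>f\<in>D. ((1 - i, (1 - 2 * i) * d), (1 - i, (1 - 2 * i) * e), (1 - i, (1 - 2 * i) * f)) \<in> Q"
  shows "\<exists>t. deficiency_op (card D) P (sidon_adj n D) t"
proof -
  let ?E = "sidon_adj n D"
  define third where "third p q = (THE ABC. ABC \<in> Q \<and> diff_key n (fst ABC) (fst (snd ABC)) = diff_key n p q)" for p q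
  define t where "t p q = (case third p q of (A, B, C) \<Rightarrow> (fst C, (snd p + snd C - snd A) mod n))" for p q
  have t: "t p q = (fst C, (snd p + snd C - snd A) mod n)"
    if "(A, B, C) \<in> Q" "diff_key n A B = diff_key n p q" for p q A B C
  proof -
    have "third p q = (A, B, C)"
      unfolding third_def
    proof (rule the_equality)
      show "X = (A, B, C)" if "X \<in> Q \<and> diff_key n (fst X) (fst (snd X)) = diff_key n p q" for X
        using once[of "fst X" "fst (snd X)" "snd (snd X)" A B C] that \<open>(A, B, C) \<in> Q\<close>
          \<open>diff_key n A B = diff_key n p q\<close> by simp
    qed (use that in simp)
    then show ?thesis by (simp add: t_def)
  qed
  have PI: "(i, x mod n) \<in> P \<longleftrightarrow> i \<in> {0, 1}" for i x using n by (auto simp: P_def)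
  have eq: "x = (y + c) mod n \<longleftrightarrow> (x - y) mod n = c mod n" if "0 \<le> x" "x < n" for x y c
  proof
    assume x: "x = (y + c) mod n"
    show "(x - y) mod n = c mod n" unfolding x by (simp add: mod_diff_left_eq)
  next
    assume "(x - y) mod n = c mod n"
    then have "(y + (x - y) mod n) mod n = (y + c mod n) mod n" by (rule arg_cong)
    then have "(y + (x - y)) mod n = (y + c) mod n" unfolding mod_add_right_eq .
    then show "x = (y + c) mod n" using that by simp
  qed
  have free: "p \<noteq> q \<and> \<not> ?E p q \<longleftrightarrow> (\<exists>A B C. (A, B, C) \<in> Q \<and> diff_key n A B = diff_key n p q)"
    if "p \<in> P" "q \<in> P" for p q
  proof -
    have b: "0 \<le> snd p" "snd p < n" "0 \<le> snd q" "snd q < n" "fst p \<in> {0, 1}" "fst q \<in> {0, 1}"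
      using that by (auto simp: P_def)
    have "snd q = snd p \<longleftrightarrow> (snd q - snd p) mod n = 0"
      using eq[OF b(3,4), of "snd p" 0] mod_pos_pos_trivial[OF b(1,2)] by simp
    then have pq: "p = q \<longleftrightarrow> fst q = fst p \<and> (snd q - snd p) mod n = 0"
      unfolding prod_eq_iff by metis
    have E: "?E p q \<longleftrightarrow> fst q = 1 - fst p \<and> (\<exists>d\<in>D. (snd q - snd p) mod n = ((1 - 2 * fst p) * d) mod n)"
      unfolding sidon_adj_def eq[OF b(3,4)] ..
    have "(\<exists>A B C. (A, B, C) \<in> Q \<and> diff_key n A B = diff_key n p q) \<longleftrightarrow>
        \<not> (fst q = fst p \<and> (snd q - snd p) mod n = 0 \<or>
          fst q = 1 - fst p \<and> (\<exists>e\<in>D. (snd q - snd p) mod n = ((1 - 2 * fst p) * e) mod n))"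
      unfolding diff_key_def[of n p q] using b n by (intro keys) auto
    then show ?thesis unfolding pq E by (simp only: de_Morgan_disj)
  qed
  have nb: "?E p q \<Longrightarrow> \<exists>d\<in>D. q = (1 - fst p, (snd p + (1 - 2 * fst p) * d) mod n)" for p q
    unfolding sidon_adj_def by (cases q) auto
  have sgn: "(1 - 2 * i) * ((1 - 2 * i) * x) = x" if "i \<in> {0, 1}" for i x :: int using that by auto
  have dkey: "diff_key n (1 - i, (a + (1 - 2 * i) * d) mod n) (1 - i, (a + (1 - 2 * i) * e) mod n) =
      diff_key n (1 - i, (1 - 2 * i) * d) (1 - i, (1 - 2 * i) * e)" for i a d e
    unfolding diff_key_def by (simp add: mod_simps)
  have shift: "((a + c) mod n + e - c) mod n = (a + e) mod n" for a c e
    unfolding add_diff_eq[symmetric] mod_add_left_eq by simp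
  have Esym: "?E q p" if pP: "p \<in> P" and pq: "?E p q" for p q
  proof -
    obtain i a where p: "p = (i, a)" "i \<in> {0, 1}" "0 \<le> a" "a < n" using pP by (auto simp: P_def)
    obtain d where d: "d \<in> D" "q = (1 - i, (a + (1 - 2 * i) * d) mod n)" using nb[OF pq] p by auto
    have "a = ((a + (1 - 2 * i) * d) mod n + (1 - 2 * (1 - i)) * d) mod n"
      unfolding mod_add_left_eq using p by (simp add: algebra_simps)
    then show ?thesis using d p by (auto simp: sidon_adj_def)
  qed
  have inj: "inj_on (\<lambda>d. (1 - i, (a + (1 - 2 * i) * d) mod n)) D" if i: "i \<in> {0, 1}" for i a
  proof (rule inj_onI)
    fix d e assume de: "d \<in> D" "e \<in> D"
      and "(1 - i, (a + (1 - 2 * i) * d) mod n) = (1 - i, (a + (1 - 2 * i) * e) mod n)"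
    then have "((a + (1 - 2 * i) * d) - a) mod n = ((a + (1 - 2 * i) * e) - a) mod n"
      by (metis mod_diff_left_eq prod.inject)
    then have "((1 - 2 * i) * ((1 - 2 * i) * d)) mod n = ((1 - 2 * i) * ((1 - 2 * i) * e)) mod n"
      by (metis add_diff_cancel_left' mod_mult_right_eq)
    then show "d = e" using D(2) de sgn[OF i] by (auto dest: inj_onD)
  qed
  have "deficiency_op (card D) P ?E t"
    unfolding deficiency_op_def
  proof (intro conjI ballI impI; (elim conjE)?)
    show "finite P" by (simp add: P_def)
    fix p assume p: "p \<in> P"
    obtain i a where ia: "p = (i, a)" "i \<in> {0, 1}" "0 \<le> a" "a < n" using p by (auto simp: P_def)
    have "{y \<in> P. ?E p y} = (\<lambda>d. (1 - i, (a + (1 - 2 * i) * d) mod n)) ` D"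
    proof (intro subset_antisym subsetI)
      fix y assume "y \<in> {y \<in> P. ?E p y}"
      then show "y \<in> (\<lambda>d. (1 - i, (a + (1 - 2 * i) * d) mod n)) ` D" using nb[of p y] ia by auto
    next
      fix y assume "y \<in> (\<lambda>d. (1 - i, (a + (1 - 2 * i) * d) mod n)) ` D"
      then show "y \<in> {y \<in> P. ?E p y}" using ia PI by (auto simp: sidon_adj_def)
    qed
    then show "card {y \<in> P. ?E p y} = card D" using card_image[OF inj[OF ia(2), of a]] by simp
    fix q assume q: "q \<in> P"
    show "?E q p" if "?E p q" using Esym p that by blast
    show "p \<noteq> q" if "?E p q" using that ia(2) by (auto simp: sidon_adj_def ia(1))
    { assume "p \<noteq> q" "\<not> ?E p q"
      then obtain A B C where Q: "(A, B, C) \<in> Q" and k: "diff_key n A B = diff_key n p q"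
        using free[OF p q] by blast
      have sd: "fst A = fst p" "fst B = fst q" and df: "(snd B - snd A) mod n = (snd q - snd p) mod n"
        using k by (auto simp: diff_key_def)
      note tpq = t[OF Q k]
      have r: "t p q \<in> P" unfolding tpq PI by (rule sides[OF Q])
      have kr: "diff_key n A C = diff_key n p (t p q)"
        unfolding tpq diff_key_def using sd by (simp add: mod_simps)
      have Q': "(A, C, B) \<in> Q" "(B, A, C) \<in> Q" using sym[OF Q] by auto
      have "p \<noteq> t p q \<and> \<not> ?E p (t p q)" using free[OF p r] Q'(1) kr by blast
      then show "t p q \<in> P" "t p q \<noteq> p" "\<not> ?E p (t p q)" using r by auto
      have "(snd p + snd B - snd A) mod n = (snd p + (snd B - snd A)) mod n" by (simp add: algebra_simps)
      also have "\<dots> = (snd p + (snd q - snd p)) mod n" using df by (metis mod_add_right_eq)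
      also have "\<dots> = snd q" using q by (auto simp: P_def)
      finally have sq: "(snd p + snd B - snd A) mod n = snd q" .
      then show "t p (t p q) = q" unfolding t[OF Q'(1) kr] using sd by (simp add: prod_eq_iff)
      have "diff_key n B A = diff_key n q p"
        unfolding diff_key_def using sd df by (metis minus_diff_eq mod_minus_cong)
      from t[OF Q'(2) this] have "t q p = (fst C, (snd q + snd C - snd B) mod n)" .
      also have "(snd q + snd C - snd B) mod n = ((snd p + snd B - snd A) + (snd C - snd B)) mod n"
        unfolding sq[symmetric] add_diff_eq[symmetric] by (rule mod_add_left_eq)
      finally show "t q p = t p q" unfolding tpq by (simp add: algebra_simps) }
    fix z assume z: "z \<in> P"
    assume E: "?E p q" "?E p z" "q \<noteq> z"
    obtain d where d: "d \<in> D" "q = (1 - i, (a + (1 - 2 * i) * d) mod n)" using nb[OF E(1)] ia by auto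
    obtain e where e: "e \<in> D" "z = (1 - i, (a + (1 - 2 * i) * e) mod n)" using nb[OF E(2)] ia by auto
    have "d \<noteq> e" using E(3) d e by auto
    then obtain f where f: "f \<in> D" and
      Q: "((1 - i, (1 - 2 * i) * d), (1 - i, (1 - 2 * i) * e), (1 - i, (1 - 2 * i) * f)) \<in> Q"
      using blocks[OF ia(2) d(1) e(1)] by blast
    show "\<not> ?E q z" using d e ia(2) by (auto simp: sidon_adj_def)
    have "t q z = (1 - i, (a + (1 - 2 * i) * f) mod n)"
      unfolding d(2) e(2) t[OF Q dkey[symmetric]] by (simp only: fst_conv snd_conv shift)
    then show "?E p (t q z)" using f ia by (auto simp: sidon_adj_def)
    show "u = p" if u: "u \<in> P" "?E u q" "?E u z" for u
    proof -
      have "fst u = i" using u(2) d ia(2) by (auto simp: sidon_adj_def)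
      then obtain b where b: "u = (i, b)" "0 \<le> b" "b < n" using u(1) by (cases u) (auto simp: P_def)
      obtain d' where d': "d' \<in> D" "q = (1 - i, (b + (1 - 2 * i) * d') mod n)" using nb[OF u(2)] b by auto
      obtain e' where e': "e' \<in> D" "z = (1 - i, (b + (1 - 2 * i) * e') mod n)" using nb[OF u(3)] b by auto
      have "d' \<noteq> e'" using E(3) d' e' by auto
      then obtain f' where
        Q': "((1 - i, (1 - 2 * i) * d'), (1 - i, (1 - 2 * i) * e'), (1 - i, (1 - 2 * i) * f')) \<in> Q"
        using blocks[OF ia(2) d'(1) e'(1)] by blast
      have "diff_key n (1 - i, (1 - 2 * i) * d) (1 - i, (1 - 2 * i) * e) =
            diff_key n (1 - i, (1 - 2 * i) * d') (1 - i, (1 - 2 * i) * e')"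
        using dkey[of i a d e] dkey[of i b d' e'] d(2) e(2) d'(2) e'(2) by simp
      from once[OF Q Q' this] have "(1 - 2 * i) * d = (1 - 2 * i) * d'" by (simp only: prod.inject)
      then have "(a + (1 - 2 * i) * d) mod n = (b + (1 - 2 * i) * d) mod n"
        using d(2) d'(2) by (simp only: prod.inject)
      then have "((a + (1 - 2 * i) * d) - (1 - 2 * i) * d) mod n = ((b + (1 - 2 * i) * d) - (1 - 2 * i) * d) mod n"
        by (metis mod_diff_left_eq)
      then show "u = p" using b ia by simp
    qed
  qed
  then show ?thesis by blast
qed

type_synonym point = "int \<times> int"

text \<open>The block of the neighbourhood of \<open>(i, 0)\<close> that corresponds to a triple of elements of \<open>D\<close>.\<close>

definition star :: "int \<Rightarrow> int \<times> int \<times> int \<Rightarrow> point \<times> point \<times> point" where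
  "star i = (\<lambda>(d, e, f). ((1 - i, (1 - 2 * i) * d), (1 - i, (1 - 2 * i) * e), (1 - i, (1 - 2 * i) * f)))"

definition orderings :: "'a \<times> 'a \<times> 'a \<Rightarrow> ('a \<times> 'a \<times> 'a) list" where
  "orderings = (\<lambda>(A, B, C). [(A, B, C), (B, A, C), (A, C, B), (C, A, B), (B, C, A), (C, B, A)])"

definition triple_keys :: "int \<Rightarrow> (point \<times> point \<times> point) list \<Rightarrow> (int \<times> int \<times> int) list" where
  "triple_keys n T = map (\<lambda>(A, B, C). diff_key n A B) (concat (map orderings T))"

text \<open>
  The keys that must not come from a base triple: those of equal points and those of adjacent points.
\<close>
definition joined_keys :: "int \<Rightarrow> int list \<Rightarrow> (int \<times> int \<times> int) list" where
  "joined_keys n D = [(0, 0, 0), (1, 1, 0)] @ map (\<lambda>d. (0, 1, d mod n)) D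
     @ map (\<lambda>d. (1, 0, (- d) mod n)) D"

definition all_keys :: "int \<Rightarrow> int list \<Rightarrow> (point \<times> point \<times> point) list \<Rightarrow> (int \<times> int \<times> int) list" where
  "all_keys n D T = joined_keys n D @ triple_keys n T"

lemma orderings_iff:
  "(A, B, C) \<in> set (orderings (X, Y, Z)) \<longleftrightarrow>
     (A, B, C) \<in> {(X, Y, Z), (Y, X, Z), (X, Z, Y), (Z, X, Y), (Y, Z, X), (Z, Y, X)}"
  by (auto simp: orderings_def)

text \<open>
  There are \<open>4 n\<close> keys in all, so a list of \<open>4 n\<close> distinct ones contains each
  exactly once. This single condition also contains that \<open>S\<close> is a Steiner triple system on
  \<open>D\<close>: the ordered pairs of elements of \<open>D\<close> covered by \<open>S\<close> have
  distinct differences, so they are distinct, and their number is that of all pairs. In particular it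
  contains that the differences of \<open>D\<close> are distinct.
\<close>
lemma deficiency_order_develop_list:
  fixes n :: int
  assumes n: "0 < n" and dist: "distinct (all_keys n D T)" and len: "int (length (all_keys n D T)) = 4 * n"
    and T: "T = map (star 0) S @ map (star 1) S @ R"
    and S: "set S \<subseteq> set D \<times> set D \<times> set D" "6 * length S = length D * (length D - 1)"
    and R: "\<And>A B C. (A, B, C) \<in> set R \<Longrightarrow> {fst A, fst B, fst C} \<subseteq> {0, 1}"
  shows "deficiency_order (length D) (2 * nat n)"
proof -
  define Q where "Q = set (concat (map orderings T))"
  have Q: "(A, B, C) \<in> Q \<longleftrightarrow> (\<exists>X Y Z. (X, Y, Z) \<in> set T \<and> (A, B, C) \<in> set (orderings (X, Y, Z)))" for A B C
    unfolding Q_def by (simp add: split_paired_Ex Bex_def)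
  have sidesT: "{fst A, fst B, fst C} \<subseteq> {0, 1}" if "(A, B, C) \<in> set T" for A B C
    using that R[of A B C] unfolding T by (auto simp: star_def)
  have sides: "{fst A, fst B, fst C} \<subseteq> {0, 1}" if "(A, B, C) \<in> Q" for A B C
  proof -
    obtain X Y Z where "(X, Y, Z) \<in> set T" "(A, B, C) \<in> set (orderings (X, Y, Z))"
      using \<open>(A, B, C) \<in> Q\<close> Q by blast
    with sidesT[of X Y Z] show ?thesis by (auto simp: orderings_iff)
  qed
  let ?K = "all_keys n D T"
  have ex3: "(\<exists>x\<in>Q. f x) \<longleftrightarrow> (\<exists>A B C. (A, B, C) \<in> Q \<and> f (A, B, C))" for f
    by (metis prod_cases3)
  have "set (triple_keys n T) = (\<lambda>(A, B, C). diff_key n A B) ` Q"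
    by (simp add: triple_keys_def Q_def)
  then have tk: "x \<in> set (triple_keys n T) \<longleftrightarrow> (\<exists>A B C. (A, B, C) \<in> Q \<and> diff_key n A B = x)" for x
    unfolding image_iff ex3 by (simp add: eq_commute image_iff ex3)
  have "set ?K \<subseteq> {0, 1} \<times> {0, 1} \<times> {0..<n}"
  proof -
    have "diff_key n A B \<in> {0, 1} \<times> {0, 1} \<times> {0..<n}" if "(A, B, C) \<in> Q" for A B C
      using sides[OF that] n by (simp add: diff_key_def)
    then have "set (triple_keys n T) \<subseteq> {0, 1} \<times> {0, 1} \<times> {0..<n}"
      unfolding subset_iff tk by metis
    then show ?thesis using n by (auto simp: all_keys_def joined_keys_def)
  qed
  moreover have "card (set ?K) = 4 * nat n" using dist len by (simp add: distinct_card)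
  moreover have "card ({0, 1::int} \<times> {0, 1::int} \<times> {0..<n}) = 4 * nat n"
    by (simp add: card_cartesian_product)
  ultimately have full: "set ?K = {0, 1} \<times> {0, 1} \<times> {0..<n}"
    by (intro card_subset_eq) auto
  have inj: "inj_on (\<lambda>(A, B, C). diff_key n A B) Q"
    using dist unfolding all_keys_def joined_keys_def triple_keys_def Q_def by (simp add: distinct_map)
  have dD: "distinct D" and iD: "inj_on (\<lambda>d. d mod n) (set D)"
    using dist unfolding all_keys_def joined_keys_def by (auto simp: distinct_map inj_on_def)
  define F where "F = set (joined_keys n D)"
  have F: "(i, k, d) \<in> F \<longleftrightarrow> k = i \<and> d = 0 \<or> k = 1 - i \<and> (\<exists>e\<in>set D. d = ((1 - 2 * i) * e) mod n)"
    if "i \<in> {0, 1}" "k \<in> {0, 1}" for i k d :: int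
    using that by (elim insertE emptyE) (simp_all add: F_def joined_keys_def image_iff)
  have disj: "set (triple_keys n T) \<inter> F = {}"
    using dist by (simp add: all_keys_def F_def Int_commute)
  have un: "set ?K = F \<union> set (triple_keys n T)"
    by (simp add: all_keys_def F_def)
  have pairs: "\<exists>f\<in>set D. (d, e, f) \<in> set (concat (map orderings S))"
    if de: "d \<in> set D" "e \<in> set D" "d \<noteq> e" for d e
  proof -
    let ?O = "concat (map orderings S)"
    let ?q = "\<lambda>(d::int, e::int, f::int). (d, e)"
    have O: "set ?O \<subseteq> set D \<times> set D \<times> set D" using S(1) by (fastforce simp: orderings_def)
    define g :: "int \<times> int \<Rightarrow> int \<times> int \<times> int" where "g = (\<lambda>(d, e). (1, 1, (e - d) mod n))"
    have "map (\<lambda>(A, B, C). diff_key n A B) (concat (map orderings (map (star 0) S))) = map g (map ?q ?O)"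
      by (induction S) (auto simp: orderings_def star_def diff_key_def g_def)
    moreover have "distinct ((1, 1, 0) # map (\<lambda>(A, B, C). diff_key n A B) (concat (map orderings (map (star 0) S))))"
      using dist unfolding all_keys_def joined_keys_def triple_keys_def T by auto
    ultimately have g: "distinct ((1, 1, 0) # map g (map ?q ?O))" by simp
    then have nz: "(1, 1, 0) \<notin> g ` set (map ?q ?O)" unfolding distinct.simps set_map by blast
    have ne: "(d, d) \<notin> set (map ?q ?O)" for d
    proof
      assume "(d, d) \<in> set (map ?q ?O)"
      then have "g (d, d) \<in> g ` set (map ?q ?O)" by (rule imageI)
      moreover have "g (d, d) = (1, 1, 0)" by (simp add: g_def)
      ultimately show False using nz by metis
    qed
    have "distinct (map ?q ?O)" using g by (simp only: distinct.simps distinct_map)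
    then have "card (set (map ?q ?O)) = length ?O" by (simp only: distinct_card length_map)
    also have "length ?O = 6 * length S" by (induction S) (auto simp: orderings_def)
    finally have "card (set (map ?q ?O)) = 6 * length S" .
    moreover have "set (map ?q ?O) \<subseteq> set D \<times> set D - Id_on (set D)"
    proof (rule subsetI)
      fix x assume x: "x \<in> set (map ?q ?O)"
      then have "x \<in> set D \<times> set D" using O by auto
      moreover have "x \<notin> Id_on (set D)" using x ne by (metis Id_onE)
      ultimately show "x \<in> set D \<times> set D - Id_on (set D)" by blast
    qed
    moreover have "card (set D \<times> set D - Id_on (set D)) = length D * (length D - 1)"
    proof -
      have "Id_on (set D) = (\<lambda>d. (d, d)) ` set D" by auto
      then have "card (Id_on (set D)) = length D"
        using dD by (simp add: card_image inj_on_def distinct_card)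
      moreover have "card (set D \<times> set D - Id_on (set D)) = card (set D \<times> set D) - card (Id_on (set D))"
        by (rule card_Diff_subset) (auto intro: finite_subset[of _ "set D \<times> set D"])
      ultimately show ?thesis
        using dD by (simp add: card_cartesian_product distinct_card diff_mult_distrib2)
    qed
    ultimately have "set (map ?q ?O) = set D \<times> set D - Id_on (set D)"
      using S(2) by (intro card_subset_eq) auto
    moreover have "(d, e) \<in> set D \<times> set D - Id_on (set D)" using de by auto
    ultimately have "(d, e) \<in> ?q ` set ?O" by (simp only: set_map)
    then obtain x where x: "x \<in> set ?O" "(d, e) = ?q x" by (rule imageE) blast
    then have "(d, e, snd (snd x)) = x" by (simp add: case_prod_unfold)
    then have "(d, e, snd (snd x)) \<in> set ?O" using x(1) by (simp only:)
    moreover from this have "snd (snd x) \<in> set D" using O by blast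
    ultimately show ?thesis by blast
  qed
  have starQ: "star i (d, e, f) \<in> Q"
    if i: "i \<in> {0, 1}" and def: "(d, e, f) \<in> set (concat (map orderings S))" for i d e f
  proof -
    obtain X Y Z where XYZ: "(X, Y, Z) \<in> set S" "(d, e, f) \<in> set (orderings (X, Y, Z))"
      using def by auto
    have "star i (X, Y, Z) \<in> set T" using XYZ(1) i unfolding T by auto
    moreover have "star i (d, e, f) \<in> set (orderings (star i (X, Y, Z)))"
      using XYZ(2) by (auto simp: orderings_def star_def)
    ultimately show ?thesis unfolding Q_def by auto
  qed
  have "\<exists>t. deficiency_op (card (set D)) ({0, 1} \<times> {0..<n}) (sidon_adj n (set D)) t"
  proof (rule deficiency_op_develop[OF n, where Q = Q])
    show "finite (set D)" by simp
    show "inj_on (\<lambda>d. d mod n) (set D)" by (rule iD)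
    show "(B, A, C) \<in> Q \<and> (A, C, B) \<in> Q" if "(A, B, C) \<in> Q" for A B C
    proof -
      obtain X Y Z where "(X, Y, Z) \<in> set T" "(A, B, C) \<in> set (orderings (X, Y, Z))"
        using \<open>(A, B, C) \<in> Q\<close> Q by blast
      moreover from this(2) have "(B, A, C) \<in> set (orderings (X, Y, Z))" "(A, C, B) \<in> set (orderings (X, Y, Z))"
        by (auto simp: orderings_iff)
      ultimately show ?thesis using Q by blast
    qed
    show "fst C \<in> {0, 1}" if "(A, B, C) \<in> Q" for A B C using sides[OF that] by simp
    show "(A, B, C) = (A', B', C')"
      if "(A, B, C) \<in> Q" "(A', B', C') \<in> Q" "diff_key n A B = diff_key n A' B'" for A B C A' B' C'
      using inj_onD[OF inj, of "(A, B, C)" "(A', B', C')"] that by simp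
    show "(\<exists>A B C. (A, B, C) \<in> Q \<and> diff_key n A B = (i, k, d)) \<longleftrightarrow>
        \<not> (k = i \<and> d = 0 \<or> k = 1 - i \<and> (\<exists>e\<in>set D. d = ((1 - 2 * i) * e) mod n))"
      if ikd: "i \<in> {0, 1}" "k \<in> {0, 1}" "0 \<le> d" "d < n" for i k d
    proof -
      have "(i, k, d) \<in> set ?K" unfolding full using ikd by simp
      then have "(i, k, d) \<in> set (triple_keys n T) \<longleftrightarrow> \<not> (i, k, d) \<in> F"
        using disj unfolding un by blast
      then show ?thesis unfolding tk F[OF ikd(1,2)] .
    qed
    show "\<exists>f\<in>set D. ((1 - i, (1 - 2 * i) * d), (1 - i, (1 - 2 * i) * e), (1 - i, (1 - 2 * i) * f)) \<in> Q"
      if "i \<in> {0, 1}" "d \<in> set D" "e \<in> set D" "d \<noteq> e" for i d e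
      using pairs[OF that(2-4)] starQ[OF that(1), unfolded star_def split] by blast
  qed
  then obtain t where "deficiency_op (card (set D)) ({0, 1} \<times> {0..<n}) (sidon_adj n (set D)) t" by blast
  from deficiency_orderI[OF this refl] show ?thesis
    using dD by (simp add: card_cartesian_product distinct_card mult_2)
qed

text \<open>
  Sets of binary numerals as binary tries, so that distinctness of some thousand keys can be decided by
  rewriting: a list is distinct iff the trie of its elements is as large as the list is long.
\<close>
datatype trie = Leaf | Node bool trie trie

fun trie_insert :: "num \<Rightarrow> trie \<Rightarrow> trie" where
  "trie_insert num.One Leaf = Node True Leaf Leaf"
| "trie_insert num.One (Node b l r) = Node True l r"
| "trie_insert (num.Bit0 k) Leaf = Node False (trie_insert k Leaf) Leaf"
| "trie_insert (num.Bit0 k) (Node b l r) = Node b (trie_insert k l) r"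
| "trie_insert (num.Bit1 k) Leaf = Node False Leaf (trie_insert k Leaf)"
| "trie_insert (num.Bit1 k) (Node b l r) = Node b l (trie_insert k r)"

fun trie_mem :: "num \<Rightarrow> trie \<Rightarrow> bool" where
  "trie_mem k Leaf = False"
| "trie_mem num.One (Node b l r) = b"
| "trie_mem (num.Bit0 k) (Node b l r) = trie_mem k l"
| "trie_mem (num.Bit1 k) (Node b l r) = trie_mem k r"

fun trie_size :: "trie \<Rightarrow> int" where
  "trie_size Leaf = 0"
| "trie_size (Node b l r) = (if b then 1 else 0) + (trie_size l + trie_size r)"

lemma trie_mem_insert: "trie_mem j (trie_insert k t) \<longleftrightarrow> j = k \<or> trie_mem j t"
proof (induction k t arbitrary: j rule: trie_insert.induct)
qed (case_tac [!] j; simp)+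

lemma trie_size_card: "finite {k. trie_mem k t} \<and> trie_size t = int (card {k. trie_mem k t})"
proof (induction t)
  case Leaf
  then show ?case by simp
next
  case (Node b l r)
  let ?B = "if b then {num.One} else {}"
  have "trie_mem k (Node b l r) \<longleftrightarrow> k \<in> ?B \<union> (num.Bit0 ` {k. trie_mem k l} \<union> num.Bit1 ` {k. trie_mem k r})" for k
    by (cases k) auto
  then have eq: "{k. trie_mem k (Node b l r)} = ?B \<union> (num.Bit0 ` {k. trie_mem k l} \<union> num.Bit1 ` {k. trie_mem k r})"
    by blast
  have "card {k. trie_mem k (Node b l r)} = card ?B + (card (num.Bit0 ` {k. trie_mem k l}) + card (num.Bit1 ` {k. trie_mem k r}))"
    unfolding eq using Node.IH by (subst card_Un_disjoint; (subst card_Un_disjoint)?; auto)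
  then show ?case using Node.IH unfolding eq by (auto simp: card_image inj_on_def)
qed

text \<open>
  The keys of each triple are inserted at once, with a running count \<open>c\<close>; the list of all
  keys is never built.
\<close>
fun fresh_keys :: "('a \<Rightarrow> num list) \<Rightarrow> int \<Rightarrow> trie \<Rightarrow> int \<Rightarrow> 'a list \<Rightarrow> bool" where
  "fresh_keys f m t c [] \<longleftrightarrow> trie_size t = m \<and> c = m"
| "fresh_keys f m t c (x # xs) \<longleftrightarrow>
     fresh_keys f m (fold trie_insert (f x) t) (c + int (length (f x))) xs"

lemma fresh_keys_iff:
  "fresh_keys f m t c xs \<longleftrightarrow>
     trie_size (fold trie_insert (concat (map f xs)) t) = m \<and> c + int (length (concat (map f xs))) = m"
  by (induction xs arbitrary: t c) (auto simp: add.assoc)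

lemma fresh_keysD:
  assumes "fresh_keys f m (fold trie_insert ks Leaf) (int (length ks)) xs"
  shows "distinct (ks @ concat (map f xs))" and "int (length (ks @ concat (map f xs))) = m"
proof -
  let ?ks = "ks @ concat (map f xs)"
  have "{k. trie_mem k (fold trie_insert js t)} = set js \<union> {k. trie_mem k t}" for js t
    by (induction js arbitrary: t) (auto simp: trie_mem_insert)
  from this[of ?ks Leaf] have "trie_size (fold trie_insert ?ks Leaf) = int (card (set ?ks))"
    using trie_size_card[of "fold trie_insert ?ks Leaf"] by simp
  moreover have "trie_size (fold trie_insert ?ks Leaf) = m" and len: "int (length ?ks) = m"
    using assms unfolding fresh_keys_iff by simp_all
  ultimately show "distinct ?ks" by (intro card_distinct) simp
  show "int (length ?ks) = m" by (rule len)
qed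

text \<open>
  Integers have to be stored as binary numerals to be pattern-matched by the trie functions; only
  positive integers are represented faithfully, which is why \<open>1\<close> is added to a residue
  before it is stored.
\<close>
definition num_of :: "int \<Rightarrow> num" where
  "num_of k = num_of_nat (nat k)"

lemma num_of_code [code]:
  "num_of (Int.Pos m) = m" "num_of 0 = num.One" "num_of (Int.Neg m) = num.One"
  by (simp_all add: num_of_def)

text \<open>The sides are put into the two lowest binary digits.\<close>

definition key_num :: "int \<times> int \<times> int \<Rightarrow> num" where
  "key_num = (\<lambda>(i, k, d). (if i = 0 then num.Bit0 else num.Bit1)
     ((if k = 0 then num.Bit0 else num.Bit1) (num_of (d + 1))))"

text \<open>
  A conditional in the form of pattern matching: after each unfolding of a conditional the rewriting
  engine would traverse its branches again, which makes filtering a long list quadratic.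
\<close>
fun skip_if :: "bool \<Rightarrow> 'a \<Rightarrow> 'a list \<Rightarrow> 'a list" where
  "skip_if True x xs = xs"
| "skip_if False x xs = x # xs"

fun absent_from :: "trie \<Rightarrow> int \<Rightarrow> nat \<Rightarrow> int list" where
  "absent_from t a 0 = []"
| "absent_from t a (Suc m) = skip_if (trie_mem (num_of a) t) a (absent_from t (a + 1) m)"

text \<open>
  One representative of each pure difference, up to sign, that does not occur in \<open>ds\<close>, in
  increasing order.
\<close>
definition free_diffs :: "int \<Rightarrow> int list \<Rightarrow> int list" where
  "free_diffs n ds =
     absent_from (fold (\<lambda>d. trie_insert (num_of (d mod n))) ds Leaf) 1 (nat (n div 2))"

text \<open>
  A cyclic Steiner triple system carried to the list \<open>D\<close>: the base blocks \<open>{0, a,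
  b}\<close> are moved around by rotating the list, and for \<open>c > 0\<close>, where the length of
  \<open>D\<close> is \<open>3 c\<close>, there is the short orbit of \<open>{0, c, 2 c}\<close>.
\<close>
definition cyclic_blocks :: "int list \<Rightarrow> (nat \<times> nat) list \<Rightarrow> nat \<Rightarrow> (int \<times> int \<times> int) list" where
  "cyclic_blocks D bs c =
     concat (map (\<lambda>i. (\<lambda>r. map (\<lambda>(a, b). (r ! 0, r ! a, r ! b)) bs) (rotate i D)) [0..<length D])
     @ map (\<lambda>i. (D ! i, D ! (i + c), D ! (i + 2 * c))) [0..<c]"

text \<open>
  Apart from the blocks in neighbourhoods and the triples \<open>ps\<close> inside side 0, every base
  triple consists of a centre on one side and two points on the other side that differ by a free
  difference \<open>a\<close>. Each difference that is free on a side occurs there once, so it suffices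
  to list, in increasing order of \<open>a\<close>, the first of the two points, \<open>es\<close> for
  side 1 and (up to sign) \<open>fs\<close> for side 0.
\<close>
definition base_triples ::
  "int \<Rightarrow> int list \<Rightarrow> (nat \<times> nat) list \<Rightarrow> nat \<Rightarrow> (int \<times> int) list \<Rightarrow> int list \<Rightarrow> int list \<Rightarrow> (point \<times> point \<times> point) list"
where
  "base_triples n D bs c ps es fs =
     map (star 0) (cyclic_blocks D bs c) @ map (star 1) (cyclic_blocks D bs c)
     @ map (\<lambda>(a, b). ((0, 0), (0, a), (0, b))) ps
     @ map (\<lambda>(a, e). ((0, 0), (1, e), (1, e + a))) (zip (free_diffs n [d - e. d \<leftarrow> D, e \<leftarrow> D]) es)
     @ map (\<lambda>(a, e). ((1, 0), (0, - e), (0, - e - a)))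
         (zip (free_diffs n ([d - e. d \<leftarrow> D, e \<leftarrow> D] @ concat (map (\<lambda>(a, b). [a, - a, b, - b, b - a, a - b]) ps))) fs)"

definition triple_nums :: "int \<Rightarrow> point \<times> point \<times> point \<Rightarrow> num list" where
  "triple_nums n ABC = map (\<lambda>(A, B, C). key_num (diff_key n A B)) (orderings ABC)"

lemma map_key_num_all_keys:
  "map key_num (all_keys n D T) = map key_num (joined_keys n D) @ concat (map (triple_nums n) T)"
  by (simp add: all_keys_def triple_keys_def triple_nums_def[abs_def] map_concat comp_def case_prod_unfold)

text \<open>
  The first two lines make sure that \<open>cyclic_blocks\<close> has the right number of blocks with
  points in \<open>D\<close>.
\<close>
definition base_check ::
  "nat \<Rightarrow> int \<Rightarrow> int list \<Rightarrow> (nat \<times> nat) list \<Rightarrow> nat \<Rightarrow> (int \<times> int) list \<Rightarrow> int list \<Rightarrow> int list \<Rightarrow> bool" where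
  "base_check w n D bs c ps es fs \<longleftrightarrow>
     0 < n \<and> length D = w \<and> 3 * c \<le> w \<and> (\<forall>(a, b)\<in>set bs. a < w \<and> b < w) \<and>
     6 * (length bs * w + c) = w * (w - 1) \<and>
     fresh_keys (triple_nums n) (4 * n)
       (fold trie_insert (map key_num (joined_keys n D)) Leaf) (int (length (map key_num (joined_keys n D))))
       (base_triples n D bs c ps es fs)"

lemma deficiency_order_base:
  assumes "base_check w n D bs c ps es fs"
  shows "deficiency_order w (2 * nat n)"
proof -
  let ?S = "cyclic_blocks D bs c" and ?T = "base_triples n D bs c ps es fs"
  have n: "0 < n" and w: "length D = w" and c: "3 * c \<le> w" and bs: "\<And>a b. (a, b) \<in> set bs \<Longrightarrow> a < w \<and> b < w"
    and card: "6 * (length bs * w + c) = w * (w - 1)"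
    and fresh: "fresh_keys (triple_nums n) (4 * n)
       (fold trie_insert (map key_num (joined_keys n D)) Leaf) (int (length (map key_num (joined_keys n D)))) ?T"
    using assms unfolding base_check_def by auto
  note keys = fresh_keysD[OF fresh, folded map_key_num_all_keys]
  have "deficiency_order (length D) (2 * nat n)"
  proof (rule deficiency_order_develop_list[OF n])
    show "distinct (all_keys n D ?T)" using keys(1) by (simp only: distinct_map)
    show "int (length (all_keys n D ?T)) = 4 * n" using keys(2) by simp
    show "?T = map (star 0) ?S @ map (star 1) ?S @ drop (2 * length ?S) ?T"
      by (simp add: base_triples_def)
    show "set ?S \<subseteq> set D \<times> set D \<times> set D"
    proof -
      have rot: "rotate i D ! a \<in> set D" if "a < w" for i a
        using nth_mem[of a "rotate i D"] that w by simp
      have "(rotate i D ! 0, rotate i D ! a, rotate i D ! b) \<in> set D \<times> set D \<times> set D"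
        if "(a, b) \<in> set bs" for i a b
        using bs[OF that] rot[of 0 i] rot[of a i] rot[of b i] by auto
      moreover have "(D ! i, D ! (i + c), D ! (i + 2 * c)) \<in> set D \<times> set D \<times> set D" if "i < c" for i
        using that c w by simp
      ultimately show ?thesis unfolding cyclic_blocks_def by auto
    qed
    have "length ?S = length bs * w + c"
      by (simp add: cyclic_blocks_def length_concat comp_def sum_list_triv w)
    then show "6 * length ?S = length D * (length D - 1)" using card w by simp
    show "{fst A, fst B, fst C} \<subseteq> {0, 1}" if "(A, B, C) \<in> set (drop (2 * length ?S) ?T)" for A B C
      using that unfolding base_triples_def by auto
  qed
  then show ?thesis by (simp add: w)
qed

section \<open>Base geometries\<close>

text \<open>
  The sets \<open>D\<close> are Golomb rulers (cut out of algebraic Sidon sets) shorter than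
  \<open>n/2\<close>, so that their differences are distinct modulo \<open>n\<close> too, and the same
  ruler serves for both moduli.
\<close>
definition ruler25 :: "int list" where
  "ruler25 =
    [0, 15, 31, 43, 107, 124, 134, 142, 145, 191, 228, 260, 289, 296, 340, 366, 406, 428, 429, 448, 453, 462, 501,
     503, 507]"

text \<open>
  The two long lists pair up the mixed differences outside \<open>D\<close>, where every pair has to
  realise a prescribed pure difference on a prescribed side. Such pairings are plentiful; these were
  found by hill climbing.
\<close>
lemma deficiency_order_25_1177: "deficiency_order 25 (2 * 1177)"
proof -
  have "base_check 25 1177 ruler25 [(1, 12), (3, 10), (4, 9), (2, 8)] 0 []
    [1175, 1043, 138, 690, 472, 717, 1124, 683, 454, 331, 459, 801, 1134, 855, 735, 720, 673, 618, 884, 128, 638,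
     152, 103, 812, 941, 367, 232, 498, 409, 578, 818, 982, 401, 1048, 794, 1022, 441, 96, 1075, 1053, 700, 550,
     867, 1137, 213, 1167, 998, 333, 968, 508, 88, 875, 131, 27, 721, 1018, 456, 609, 992, 803, 1084, 827, 383,
     661, 524, 81, 381, 1105, 568, 146, 1138, 570, 345, 542, 447, 466, 473, 1038, 236, 983, 767, 896, 245, 75,
     1031, 1052, 736, 561, 724, 398, 24, 156, 282, 318, 581, 942, 137, 669, 527, 1082, 1060, 623, 255, 465, 613,
     1100, 723, 881, 83, 913, 790, 217, 387, 1107, 817, 62, 403, 1172, 1001, 424, 1101, 763, 165, 859, 40, 470,
     499, 740, 745, 574, 872, 1143, 1151, 848, 108, 954, 999, 658, 52, 931, 789, 963, 1090, 1098, 1050, 1069, 242,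
     1161, 7, 795, 647, 979, 828, 1108, 380, 937, 196, 350, 800, 589, 864, 1044, 625, 695, 455, 908, 816, 702, 569,
     315, 36, 1067, 189, 644, 1171, 484, 916, 45, 444, 310, 645, 987, 877, 197, 560, 1168, 28, 651, 957, 842, 121,
     279, 204, 1071, 636, 483, 405, 99, 694, 1042, 203, 179, 141, 726, 347, 536, 558, 883, 1028, 311, 540, 938,
     741, 1131, 256, 481, 1166, 407, 148, 287, 135, 936, 898, 688, 861, 393, 1027, 434, 452, 410, 16, 869, 490,
     715, 1120, 494, 1103, 1009, 697, 56, 608, 704, 400, 858, 432, 376, 902, 339, 733, 416, 442, 571, 47, 708, 900,
     539, 218, 487, 8, 865, 474, 382, 526, 590, 785, 904, 143, 738, 950, 595, 960, 402, 923, 1029, 619, 440, 991,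
     905, 163, 1130, 512, 335, 37, 1085, 95, 101, 528, 707]
    [307, 970, 39, 776, 496, 111, 543, 155, 1129, 292, 677, 946, 223, 1, 202, 749, 283, 178, 874, 348, 352, 826,
     76, 978, 551, 634, 663, 1162, 419, 476, 2, 699, 364, 617, 231, 363, 55, 732, 598, 879, 808, 1079, 515, 301,
     325, 386, 786, 343, 1061, 685, 25, 798, 168, 1056, 1104, 497, 805, 952, 113, 449, 576, 1080, 1140, 1020, 517,
     9, 1047, 939, 959, 840, 885, 94, 1102, 243, 415, 711, 1032, 229, 421, 1049, 1097, 670, 238, 251, 187, 86,
     1092, 305, 150, 521, 332, 579, 294, 1121, 433, 958, 666, 722, 1014, 329, 1116, 439, 901, 557, 493, 779, 756,
     649, 475, 185, 505, 856, 964, 754, 379, 577, 79, 262, 730, 373, 6, 985, 222, 955, 258, 750, 945, 820, 535,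
     1040, 932, 396, 60, 446, 389, 832, 127, 477, 511, 914, 1011, 357, 265, 234, 290, 469, 266, 709, 1174, 681,
     876, 961, 1010, 82, 399, 199, 605, 1003, 727, 615, 253, 323, 1026, 68, 890, 295, 752, 814, 565, 773, 212, 739,
     288, 611, 825, 130, 435, 627, 151, 211, 584, 846, 1072, 1160, 718, 417, 1141, 491, 160, 192, 482, 764, 500,
     823, 956, 930, 353, 249, 488, 1007, 395, 355, 599, 257, 655, 682, 891, 420, 180, 385, 300, 358, 309, 110, 314,
     119, 659, 194, 995, 485, 1106, 140, 316, 824, 990, 562, 3, 566, 12, 882, 716, 1063, 486, 588, 593, 413, 1153,
     44, 672, 585, 810, 326, 122, 89, 291, 696, 1155, 837, 607, 361, 397, 621, 227, 303, 46, 1015, 1078, 947, 580,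
     929, 603, 304, 731, 880, 359, 275, 1147, 725, 341, 626, 520, 422, 215, 259, 54, 572, 201, 5, 631, 933, 653, 4,
     529, 691, 451, 1146, 774, 125]"
    by code_simp
  from deficiency_order_base[OF this] show ?thesis by simp
qed

lemma deficiency_order_25_1183: "deficiency_order 25 (2 * 1183)"
proof -
  have "base_check 25 1183 ruler25 [(1, 12), (3, 10), (4, 9), (2, 8)] 0 [(350, 703)]
    [1152, 943, 392, 454, 13, 22, 652, 998, 731, 1075, 151, 1087, 476, 1063, 1109, 750, 752, 398, 532, 671, 481,
     741, 1035, 1020, 578, 352, 1012, 886, 405, 1164, 539, 103, 335, 302, 735, 295, 65, 647, 947, 1102, 791, 744,
     612, 278, 1117, 423, 921, 543, 1057, 1076, 420, 866, 721, 28, 1009, 624, 719, 1134, 779, 84, 1115, 634, 1043,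
     601, 322, 864, 44, 397, 600, 238, 592, 1053, 301, 704, 265, 1107, 691, 32, 621, 1077, 431, 434, 747, 674, 751,
     178, 1180, 479, 383, 380, 298, 40, 257, 111, 928, 48, 567, 771, 1028, 904, 276, 620, 62, 822, 141, 1161, 214,
     297, 368, 662, 680, 118, 203, 404, 678, 688, 967, 466, 135, 910, 734, 1111, 140, 97, 835, 463, 520, 449, 1125,
     748, 76, 655, 229, 258, 526, 985, 918, 545, 1072, 45, 131, 906, 557, 801, 885, 602, 672, 201, 197, 820, 845,
     1099, 709, 239, 268, 793, 563, 632, 653, 544, 249, 490, 812, 402, 79, 159, 605, 849, 817, 450, 717, 19, 558,
     245, 788, 1080, 409, 237, 1119, 286, 227, 1029, 1120, 905, 1146, 362, 372, 359, 46, 924, 950, 1095, 452, 485,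
     209, 789, 727, 893, 519, 456, 703, 136, 72, 548, 1174, 1033, 458, 108, 89, 86, 660, 888, 1065, 254, 658, 475,
     813, 949, 418, 188, 729, 615, 1085, 327, 419, 767, 412, 521, 451, 1032, 1091, 1014, 1168, 382, 1154, 698, 232,
     1039, 36, 847, 840, 935, 60, 455, 457, 396, 984, 799, 787, 443, 1129, 280, 115, 269, 283, 440, 186, 808, 464,
     760, 705, 1144, 242, 880, 594, 865, 1093, 859, 794, 533, 761, 120, 222, 324, 829, 778, 223, 179, 1017, 1157,
     318, 1088, 30, 970, 1082, 770, 17, 334, 927, 1008, 361]
    [966, 989, 804, 551, 176, 119, 566, 386, 343, 310, 908, 619, 560, 1010, 675, 114, 35, 1110, 271, 917, 527,
     1143, 6, 1141, 1122, 2, 93, 1016, 1081, 900, 854, 240, 117, 932, 155, 737, 931, 925, 460, 860, 659, 64, 328,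
     857, 782, 669, 154, 730, 1090, 360, 1182, 758, 262, 1138, 292, 95, 391, 231, 170, 102, 923, 716, 807, 474,
     384, 1071, 786, 347, 837, 92, 875, 766, 722, 58, 582, 825, 920, 212, 312, 1078, 10, 561, 417, 995, 843, 12,
     492, 309, 833, 538, 401, 887, 581, 175, 33, 828, 764, 559, 91, 489, 754, 874, 400, 1038, 129, 473, 780, 798,
     20, 342, 385, 618, 1056, 564, 337, 650, 357, 226, 590, 122, 550, 80, 499, 106, 1089, 75, 1092, 785, 241, 374,
     68, 958, 408, 133, 1018, 56, 303, 1112, 1044, 926, 955, 1042, 253, 534, 1045, 809, 986, 514, 256, 587, 695,
     699, 250, 629, 524, 666, 353, 139, 152, 1037, 1150, 213, 59, 504, 98, 1086, 441, 424, 234, 196, 1123, 219,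
     437, 702, 573, 513, 174, 878, 1155, 802, 570, 287, 332, 293, 861, 638, 1166, 100, 1025, 88, 206, 281, 1006,
     714, 251, 190, 858, 679, 1060, 681, 901, 320, 790, 862, 1001, 306, 646, 631, 1179, 270, 377, 158, 981, 319,
     726, 34, 49, 576, 390, 291, 55, 622, 436, 113, 7, 522, 77, 445, 350, 606, 593, 625, 839, 963, 556, 224, 810,
     21, 742, 687, 517, 208, 914, 1011, 1100, 148, 1170, 648, 210, 1062, 230, 797, 263, 892, 546, 85, 336, 4, 571,
     218, 894, 438, 971, 720, 642, 775, 670, 255, 8, 378, 52, 459, 216, 1036, 994, 305, 365, 367, 745, 1, 393, 661,
     285, 426, 26, 259, 536, 339]"
    by code_simp
  from deficiency_order_base[OF this] show ?thesis by simp
qed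

definition ruler27 :: "int list" where
  "ruler27 =
    [0, 37, 45, 71, 84, 87, 89, 109, 145, 188, 220, 271, 298, 302, 317, 326, 383, 393, 394, 442, 456, 463, 496,
     549, 561, 584, 590]"

lemma deficiency_order_27_1379: "deficiency_order 27 (2 * 1379)"
proof -
  have "base_check 27 1379 ruler27 [(1, 13), (3, 11), (4, 10), (2, 7)] 9 []
    [1299, 780, 953, 930, 1095, 1014, 776, 127, 1002, 742, 483, 76, 766, 1256, 1038, 821, 1140, 1102, 853, 1114,
     215, 866, 325, 579, 959, 97, 992, 1006, 261, 1281, 425, 497, 419, 381, 1320, 1238, 715, 1109, 1017, 447, 538,
     64, 282, 491, 342, 747, 339, 1243, 1090, 1124, 847, 696, 587, 984, 295, 373, 1119, 39, 1325, 310, 437, 658,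
     132, 1145, 489, 374, 1070, 439, 236, 880, 253, 884, 917, 70, 433, 855, 862, 480, 77, 835, 694, 1034, 1251,
     299, 631, 963, 623, 939, 1072, 717, 1181, 7, 487, 1235, 60, 1099, 606, 841, 1257, 510, 1153, 390, 1290, 822,
     1221, 227, 401, 358, 1027, 1188, 1118, 6, 1349, 270, 940, 1363, 964, 1284, 1205, 795, 404, 830, 303, 289, 890,
     749, 1137, 34, 690, 1357, 1341, 116, 585, 511, 1084, 172, 294, 201, 138, 1012, 1075, 386, 544, 948, 654, 577,
     1279, 591, 365, 14, 961, 798, 1057, 582, 876, 1187, 228, 977, 432, 912, 12, 1049, 744, 1233, 1009, 522, 263,
     11, 461, 1274, 1255, 598, 967, 278, 1369, 627, 878, 130, 904, 1032, 279, 519, 833, 277, 290, 612, 1135, 136,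
     1174, 928, 616, 1378, 512, 1185, 248, 797, 402, 508, 947, 429, 166, 1116, 134, 1322, 975, 1064, 1264, 468,
     731, 212, 570, 1168, 1169, 51, 729, 118, 1367, 1265, 1373, 83, 980, 102, 1194, 40, 234, 443, 1055, 304, 124,
     399, 431, 956, 589, 1007, 47, 937, 680, 67, 547, 340, 533, 651, 949, 782, 617, 186, 173, 311, 1041, 506, 1155,
     5, 321, 222, 1120, 268, 492, 736, 482, 597, 799, 320, 288, 66, 661, 663, 994, 990, 350, 1039, 871, 1376, 1355,
     672, 382, 889, 272, 195, 214, 254, 355, 275, 1268, 599, 518, 697, 849, 541, 1058, 851, 790, 1296, 521, 1375,
     117, 1206, 105, 785, 525, 209, 1106, 805, 837, 19, 398, 257, 1223, 788, 10, 1219, 767, 1078, 682, 363, 1123,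
     716, 698, 20, 938, 1074, 1335, 504, 198, 412, 574, 1156, 893, 1080, 126, 691, 819, 238, 131, 1269, 49, 1240,
     219, 1286]
    [1143, 428, 699, 557, 176, 1214, 515, 199, 292, 100, 1131, 31, 618, 843, 1199, 816, 141, 52, 891, 1294, 1126,
     264, 341, 764, 840, 1191, 644, 1239, 353, 316, 852, 842, 1245, 1300, 752, 1030, 1121, 905, 1310, 451, 760,
     396, 1061, 1037, 146, 746, 1082, 180, 898, 738, 459, 232, 28, 713, 389, 823, 388, 210, 315, 280, 154, 955,
     170, 1336, 338, 452, 43, 357, 653, 1198, 1323, 906, 1081, 629, 957, 249, 457, 559, 274, 1093, 1242, 1351,
     1230, 1071, 333, 719, 1309, 94, 360, 732, 576, 204, 565, 695, 935, 1289, 583, 142, 78, 258, 1003, 1184, 773,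
     1319, 945, 1229, 265, 86, 1023, 466, 982, 324, 593, 513, 444, 42, 499, 1314, 1139, 839, 1053, 153, 309, 787,
     1227, 1004, 778, 578, 789, 129, 1036, 801, 400, 80, 751, 297, 101, 125, 660, 486, 140, 507, 1104, 725, 1088,
     1151, 416, 834, 1311, 1321, 1276, 668, 645, 193, 723, 1303, 826, 679, 918, 639, 568, 1328, 558, 421, 858,
     1097, 1183, 1344, 671, 361, 861, 602, 1164, 528, 710, 730, 414, 1040, 859, 1211, 638, 1172, 462, 666, 517,
     368, 870, 796, 722, 208, 543, 1089, 273, 1249, 867, 218, 926, 133, 845, 312, 1001, 950, 90, 98, 313, 57, 332,
     727, 1159, 150, 8, 509, 1252, 1342, 1354, 1302, 545, 603, 542, 200, 242, 434, 514, 779, 33, 919, 942, 322,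
     1047, 739, 934, 566, 1333, 1241, 979, 1231, 336, 794, 1343, 803, 1258, 705, 163, 825, 733, 1266, 120, 194,
     1350, 351, 1262, 152, 829, 1204, 356, 93, 1115, 345, 481, 1295, 874, 143, 1149, 464, 367, 1179, 213, 1068,
     828, 546, 1362, 630, 35, 903, 556, 941, 266, 929, 1146, 709, 269, 986, 734, 991, 1163, 1190, 520, 48, 946,
     455, 169, 1209, 1285, 75, 167, 879, 726, 1261, 1101, 564, 165, 686, 677, 30, 846, 406, 224, 446, 203, 1196,
     202, 65, 1130, 1085, 626, 255, 552, 969, 328, 1203, 643, 1348, 183, 1035, 1313, 426, 1076, 581, 493, 243, 231,
     664, 892, 775, 1308, 465, 1060, 895]"
    by code_simp
  from deficiency_order_base[OF this] show ?thesis by simp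
qed

lemma deficiency_order_27_1385: "deficiency_order 27 (2 * 1385)"
proof -
  have "base_check 27 1385 ruler27 [(1, 13), (3, 11), (4, 10), (2, 7)] 9 [(320, 654)]
    [611, 262, 374, 97, 547, 701, 377, 612, 811, 36, 256, 223, 327, 1061, 844, 906, 815, 41, 267, 1145, 1102, 1092,
     613, 966, 583, 840, 836, 336, 1119, 509, 1149, 158, 892, 181, 330, 485, 245, 978, 1037, 102, 1047, 529, 872,
     355, 465, 111, 889, 1068, 1225, 806, 843, 973, 858, 656, 515, 1240, 891, 688, 521, 228, 1367, 941, 1122, 658,
     422, 594, 1130, 386, 557, 252, 197, 168, 1191, 507, 955, 780, 1136, 222, 668, 1377, 1364, 321, 1134, 1139,
     1050, 1249, 3, 674, 729, 92, 741, 918, 320, 1186, 817, 324, 417, 501, 499, 920, 1161, 598, 1002, 647, 522,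
     1048, 958, 768, 68, 622, 696, 546, 459, 664, 363, 1233, 319, 289, 130, 202, 695, 1275, 582, 1247, 1073, 642,
     732, 1101, 874, 132, 945, 11, 205, 300, 1160, 879, 1056, 876, 1323, 452, 53, 99, 269, 1373, 42, 770, 288, 775,
     1280, 1203, 83, 1187, 964, 1351, 1276, 190, 1205, 763, 441, 982, 195, 492, 1297, 1348, 676, 266, 1295, 122,
     657, 661, 1107, 554, 364, 956, 134, 296, 724, 822, 32, 927, 123, 626, 1018, 74, 855, 779, 337, 802, 1300, 488,
     1069, 1344, 1029, 312, 1165, 807, 1257, 1189, 392, 1006, 199, 963, 57, 865, 559, 155, 1283, 556, 1260, 852,
     885, 201, 853, 969, 870, 1338, 924, 381, 1103, 82, 140, 523, 1340, 1049, 342, 1150, 992, 1175, 1209, 391,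
     1243, 420, 437, 179, 778, 1, 1163, 689, 558, 1245, 968, 1135, 720, 932, 1098, 1005, 1220, 654, 1229, 139,
     1096, 804, 385, 339, 133, 792, 331, 70, 29, 993, 1157, 184, 744, 462, 592, 512, 783, 597, 1356, 1266, 234,
     796, 1105, 1384, 446, 1015, 1361, 1261, 1025, 240, 809, 1188, 854, 435, 1084, 1291, 712, 551, 894, 51, 1217,
     1026, 716, 987, 1071, 751, 825, 997, 1080, 1349, 358, 287, 28, 396, 524, 23, 580, 533, 666, 537, 1382, 1262,
     108, 1325, 1258, 942, 738, 878, 476, 466, 428, 752, 212, 851, 901, 1337, 1379, 985, 1301, 291, 1237, 511, 161,
     408, 743, 1184, 10, 677, 1156, 178, 416]
    [960, 620, 585, 1231, 1062, 965, 194, 475, 423, 530, 839, 834, 864, 846, 47, 98, 193, 535, 781, 600, 27, 1088,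
     734, 828, 1228, 1196, 623, 214, 841, 1312, 304, 830, 1320, 857, 1219, 121, 230, 137, 24, 411, 994, 1362, 776,
     1089, 249, 1017, 1082, 1028, 1222, 1075, 115, 1236, 805, 581, 974, 726, 976, 951, 630, 94, 619, 460, 1115,
     1183, 236, 769, 67, 167, 481, 90, 472, 1375, 962, 250, 565, 356, 1226, 816, 351, 107, 8, 1380, 699, 379, 229,
     1215, 1354, 1131, 204, 880, 1038, 376, 838, 1004, 513, 310, 746, 360, 898, 800, 1329, 235, 1376, 1033, 719,
     1378, 1036, 221, 670, 43, 251, 1287, 104, 900, 790, 681, 723, 882, 1269, 1179, 683, 859, 182, 774, 1200, 912,
     55, 928, 578, 986, 610, 185, 467, 378, 177, 541, 152, 660, 276, 1185, 923, 173, 873, 566, 866, 1285, 750,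
     1181, 925, 429, 821, 771, 160, 263, 1012, 1171, 503, 293, 1126, 636, 516, 203, 757, 643, 100, 1284, 567, 835,
     1307, 1346, 1155, 63, 311, 961, 1265, 143, 369, 569, 1234, 785, 445, 934, 425, 303, 722, 482, 531, 902, 1290,
     238, 506, 711, 616, 491, 1152, 905, 260, 77, 406, 1324, 685, 693, 135, 1114, 1095, 801, 1166, 12, 1085, 573,
     1241, 154, 468, 1270, 1267, 887, 824, 907, 588, 1055, 350, 348, 715, 490, 38, 888, 1221, 1140, 789, 242, 174,
     216, 895, 538, 575, 106, 1007, 409, 268, 1311, 1076, 427, 1143, 169, 1020, 579, 837, 678, 936, 1060, 299,
     1204, 96, 255, 913, 209, 150, 156, 1078, 691, 937, 116, 295, 469, 1339, 938, 329, 593, 246, 254, 1281, 975,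
     1081, 725, 700, 1210, 2, 1113, 1193, 401, 947, 532, 861, 1148, 564, 244, 863, 798, 1232, 1259, 415, 1224,
     1040, 144, 1374, 198, 983, 18, 81, 1120, 35, 387, 274, 353, 1271, 290, 655, 914, 908, 1263, 1199, 1197, 328,
     544, 794, 1318, 1381, 990, 226, 110, 727, 117, 1023, 608, 919, 493, 26, 648, 72, 1251, 163, 1334, 703, 617,
     138, 1195, 119, 1345]"
    by code_simp
  from deficiency_order_base[OF this] show ?thesis by simp
qed

definition ruler31 :: "int list" where
  "ruler31 =
    [0, 7, 12, 86, 92, 117, 162, 175, 275, 301, 304, 340, 363, 415, 465, 481, 483, 536, 537, 574, 584, 614, 618,
     635, 681, 708, 722, 730, 741, 750, 765]"

lemma deficiency_order_31_1831: "deficiency_order 31 (2 * 1831)"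
proof -
  have "base_check 31 1831 ruler31 [(1, 15), (3, 13), (4, 12), (5, 11), (2, 9)] 0 []
    [1475, 695, 336, 1487, 1387, 1794, 1043, 651, 1250, 862, 1352, 93, 1038, 867, 27, 1469, 261, 35, 1295, 1385,
     425, 1412, 1544, 1562, 285, 166, 756, 875, 1307, 1476, 610, 1686, 110, 808, 1128, 228, 999, 497, 1391, 1683,
     493, 1348, 1278, 659, 1136, 1672, 431, 1483, 1195, 652, 244, 701, 1417, 1700, 802, 980, 356, 944, 1187, 887,
     1496, 1505, 934, 66, 316, 940, 979, 745, 1578, 1213, 1257, 157, 461, 1287, 547, 1462, 229, 1330, 421, 589,
     923, 1108, 871, 896, 10, 1803, 1219, 738, 984, 292, 552, 1401, 616, 848, 410, 1338, 797, 479, 894, 773, 1812,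
     1152, 895, 653, 1551, 1717, 207, 501, 1102, 1021, 776, 277, 571, 751, 630, 654, 1302, 305, 1169, 1414, 1458,
     551, 672, 529, 392, 1274, 1264, 211, 1208, 1805, 719, 732, 829, 153, 77, 262, 1637, 308, 1198, 978, 1436,
     1045, 1488, 1525, 860, 725, 1153, 1149, 646, 1373, 1119, 1806, 592, 1749, 1411, 1066, 1277, 664, 333, 1722,
     1004, 874, 402, 788, 1017, 201, 628, 915, 1117, 1335, 393, 558, 957, 564, 376, 631, 318, 795, 30, 1109, 1604,
     1085, 953, 1826, 1682, 361, 705, 1532, 1130, 1304, 440, 1009, 1380, 47, 966, 208, 928, 881, 1083, 852, 1265,
     26, 637, 1657, 271, 642, 673, 1731, 1114, 1730, 950, 524, 239, 632, 987, 375, 1452, 924, 482, 498, 1592, 170,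
     579, 389, 24, 1581, 573, 1166, 74, 1381, 1392, 58, 1190, 1613, 236, 1184, 1659, 1595, 825, 1634, 105, 1590,
     737, 1721, 1172, 1661, 1248, 1670, 927, 1103, 240, 1609, 64, 1386, 655, 772, 888, 1489, 1630, 1740, 952, 1424,
     1371, 1092, 1830, 294, 321, 1408, 476, 1294, 968, 300, 910, 485, 1224, 1020, 1202, 1499, 1126, 977, 1233, 138,
     906, 192, 595, 1255, 374, 357, 1074, 413, 1220, 565, 717, 439, 22, 1770, 53, 1800, 1306, 815, 1003, 983, 1,
     256, 976, 619, 198, 224, 436, 1744, 967, 1623, 1253, 183, 760, 468, 1828, 499, 98, 1526, 982, 1549, 280, 1640,
     1178, 1419, 540, 127, 1170, 1270, 1494, 1247, 1384, 893, 1440, 1822, 212, 1351, 519, 639, 309, 1512, 1814,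
     1758, 897, 1135, 807, 172, 1206, 603, 1574, 1596, 472, 886, 743, 337, 676, 1157, 1632, 339, 1413, 948, 1625,
     1084, 821, 250, 269, 263, 513, 1767, 1438, 257, 947, 1575, 1088, 811, 347, 1504, 1039, 1154, 1752, 484, 1500,
     826, 1729, 1111, 714, 1221, 1268, 965, 647, 1656, 1759, 1666, 152, 824, 401, 1653, 840, 1784, 1297, 424, 567,
     1518, 307, 13, 763, 1823, 1026, 693, 245, 1514, 586, 1614, 907, 866, 1239, 587, 1214, 617, 938, 690, 728, 297,
     1256, 1739, 16, 407, 445, 31, 1015, 1070, 184, 352, 1061, 1090, 988, 914, 1529, 1299, 611, 109, 1137, 1582,
     838, 1044, 709, 441, 902, 489]
    [154, 1211, 1382, 227, 1325, 55, 1431, 1131, 220, 1173, 346, 126, 864, 1422, 1005, 1757, 949, 150, 1680, 800,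
     929, 1501, 1655, 1167, 861, 17, 839, 597, 39, 1402, 265, 1261, 446, 405, 21, 1813, 712, 147, 687, 1197, 1192,
     1273, 108, 4, 904, 1398, 1585, 761, 279, 1654, 287, 525, 48, 641, 955, 1718, 566, 1573, 555, 609, 474, 1713,
     1218, 1479, 38, 1799, 1523, 144, 206, 1421, 219, 1738, 128, 210, 1557, 809, 1063, 49, 1160, 1491, 857, 1531,
     1416, 844, 643, 758, 1829, 667, 284, 522, 8, 1786, 572, 417, 1315, 1449, 599, 1018, 533, 341, 1356, 1691,
     1426, 956, 1534, 747, 733, 665, 1676, 19, 1560, 1658, 470, 845, 164, 1687, 500, 1453, 89, 796, 1343, 274, 713,
     1134, 1727, 70, 1733, 945, 1644, 96, 216, 1279, 1370, 246, 515, 1761, 202, 1203, 11, 1280, 1228, 185, 398,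
     623, 869, 457, 1340, 467, 1065, 1448, 1000, 576, 1322, 475, 1482, 1728, 520, 506, 121, 193, 1490, 1328, 1492,
     1234, 1456, 507, 199, 1597, 613, 1520, 102, 381, 1618, 1104, 1133, 114, 753, 191, 182, 510, 104, 451, 429,
     1732, 1372, 575, 1425, 925, 1688, 674, 554, 1495, 877, 1124, 264, 1051, 1430, 1342, 46, 1046, 1429, 1345, 173,
     1349, 1407, 163, 1576, 868, 1375, 1777, 1329, 1361, 1292, 494, 885, 627, 1665, 1702, 456, 477, 783, 901, 1229,
     1556, 1036, 437, 1379, 726, 1215, 1033, 1112, 103, 362, 1393, 248, 1709, 100, 679, 1603, 1521, 820, 1100, 369,
     837, 18, 495, 1396, 384, 322, 1078, 1663, 1071, 752, 1459, 1395, 1764, 255, 176, 313, 235, 919, 1146, 1366,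
     1481, 1792, 1480, 909, 251, 179, 9, 1710, 890, 739, 830, 1572, 990, 187, 1179, 700, 804, 514, 1737, 727, 1701,
     95, 1432, 1754, 1465, 412, 856, 518, 600, 601, 770, 1642, 794, 112, 419, 697, 1712, 675, 900, 1724, 905, 836,
     606, 107, 1643, 550, 1559, 789, 72, 1447, 40, 1791, 1209, 624, 266, 509, 420, 289, 1612, 1530, 847, 1327, 15,
     1374, 1741, 295, 1378, 650, 744, 644, 231, 223, 994, 1367, 683, 1443, 288, 842, 1143, 1376, 460, 656, 640,
     1399, 50, 787, 1058, 135, 1410, 1548, 382, 876, 1474, 612, 1765, 931, 958, 542, 1802, 178, 1069, 1095, 557,
     1140, 527, 101, 1558, 358, 79, 941, 1053, 273, 1350, 932, 1778, 816, 870, 71, 1062, 823, 1810, 282, 1037, 846,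
     1001, 1827, 1798, 1056, 1522, 511, 422, 367, 1313, 749, 319, 541, 296, 1461, 942, 1317, 718, 580, 532, 666,
     386, 1815, 1326, 1790, 543, 1076, 260, 1649, 428, 1607, 204, 1394, 991, 1772, 1303, 696, 1151, 120, 1318,
     1241, 1515, 1240, 1570, 960, 649, 400, 973, 636, 1363, 1633, 1258, 194, 1736, 1310, 1679, 1199, 1781, 320,
     1237, 161, 689, 1312, 1226]"
    by code_simp
  from deficiency_order_base[OF this] show ?thesis by simp
qed

lemma deficiency_order_31_1837: "deficiency_order 31 (2 * 1837)"
proof -
  have "base_check 31 1837 ruler31 [(1, 15), (3, 13), (4, 12), (5, 11), (2, 9)] 0 [(322, 807)]
    [771, 1745, 477, 1423, 1009, 1772, 445, 1208, 1063, 1617, 834, 1592, 1406, 1647, 788, 1433, 359, 800, 1736,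
     1689, 472, 1518, 1308, 530, 245, 701, 11, 368, 149, 428, 23, 818, 386, 1553, 1792, 59, 1340, 1710, 548, 1683,
     660, 494, 1061, 1102, 748, 462, 947, 871, 654, 1271, 599, 1302, 1193, 621, 354, 729, 1789, 1659, 689, 746,
     687, 405, 434, 905, 753, 126, 1283, 193, 1177, 158, 1545, 52, 787, 400, 1212, 1195, 278, 578, 1714, 991, 951,
     506, 1347, 1082, 1369, 595, 963, 565, 1677, 1007, 1621, 847, 1289, 338, 467, 797, 1639, 1776, 1006, 1660,
     1291, 170, 1748, 1797, 1245, 353, 1685, 378, 980, 1609, 793, 659, 619, 1112, 1536, 231, 1161, 1085, 597, 295,
     1641, 1757, 1097, 890, 1075, 1440, 1113, 418, 53, 885, 1099, 1091, 1479, 921, 1176, 935, 891, 1600, 631, 993,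
     1295, 630, 848, 436, 1704, 518, 1315, 912, 1414, 242, 471, 1422, 488, 446, 401, 410, 339, 391, 383, 756, 758,
     1048, 1770, 1224, 430, 525, 1403, 1264, 655, 1221, 1570, 196, 1026, 998, 1741, 1492, 944, 1118, 1141, 109,
     1077, 593, 1002, 646, 246, 380, 1175, 262, 870, 679, 69, 1491, 733, 161, 490, 612, 1290, 82, 248, 372, 737,
     768, 1533, 1038, 1694, 806, 131, 1548, 827, 1217, 1409, 1364, 1638, 859, 1614, 1484, 281, 1226, 927, 1366,
     1249, 243, 632, 609, 46, 1101, 1105, 844, 1788, 1399, 1711, 1126, 1045, 1469, 148, 1323, 1114, 669, 253, 1216,
     416, 992, 1669, 9, 110, 377, 171, 486, 1565, 1203, 1107, 1499, 1510, 1810, 709, 1531, 201, 1477, 130, 588,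
     1350, 971, 552, 478, 45, 987, 256, 759, 25, 1655, 1234, 1743, 1214, 757, 1067, 1381, 1744, 1320, 41, 1486,
     1625, 625, 235, 1330, 661, 954, 440, 950, 1307, 1117, 1730, 337, 310, 261, 404, 742, 320, 439, 485, 16, 165,
     989, 166, 1804, 1446, 1273, 873, 744, 1011, 1458, 1463, 433, 1322, 1253, 177, 309, 1384, 644, 1540, 47, 532,
     568, 1564, 1348, 461, 964, 284, 1204, 1576, 972, 760, 1019, 1765, 93, 113, 321, 1259, 1670, 1124, 857, 1133,
     952, 484, 1324, 1791, 1818, 1103, 376, 392, 1607, 200, 943, 1054, 1300, 1390, 918, 1357, 458, 328, 545, 1449,
     1227, 1428, 1774, 1735, 855, 734, 1389, 508, 1589, 1604, 1223, 1060, 1065, 292, 1822, 846, 1441, 1156, 384,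
     390, 1519, 1263, 617, 784, 220, 1474, 1700, 76, 1379, 693, 259, 1255, 1750, 534, 449, 1646, 924, 915, 1532,
     1525, 509, 1528, 1135, 1375, 1246, 1429, 724, 956, 1786, 1552, 1773, 581, 141, 1173, 56, 1073, 463, 863, 1836,
     1191, 1546, 752, 978, 747, 1185, 539, 961, 147, 1337, 547, 1516, 427, 1352, 613, 881, 1475, 828, 468, 1276,
     144, 1496, 1580, 781, 272, 981, 1336, 398, 206, 662, 1698, 15, 808]
    [1136, 735, 1461, 466, 367, 1713, 977, 1424, 1, 1746, 49, 1086, 1643, 1538, 1200, 1121, 172, 482, 1831, 470,
     962, 305, 1164, 874, 1668, 1137, 620, 1654, 1494, 1057, 387, 875, 1555, 917, 1529, 1167, 1507, 358, 1561, 521,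
     116, 1721, 1832, 1824, 349, 1434, 1230, 535, 997, 1106, 823, 1664, 663, 1257, 350, 829, 497, 553, 95, 1814,
     1420, 656, 382, 143, 1590, 904, 457, 495, 1256, 1522, 501, 1042, 1567, 562, 1559, 302, 54, 1457, 1402, 1031,
     1619, 524, 664, 1586, 1742, 703, 355, 1632, 341, 1454, 1262, 897, 230, 360, 718, 4, 1489, 1265, 1278, 851,
     610, 197, 920, 1563, 1327, 1623, 1269, 1485, 692, 1618, 1356, 571, 99, 1695, 371, 187, 1162, 1421, 1368, 531,
     1000, 710, 1691, 1035, 688, 990, 986, 473, 1657, 426, 878, 70, 769, 1425, 894, 624, 389, 114, 1274, 946, 1285,
     666, 721, 1079, 1316, 1498, 677, 1378, 1094, 1288, 856, 810, 1438, 345, 570, 1508, 1174, 821, 1145, 493, 314,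
     476, 1411, 480, 1591, 331, 579, 1554, 1013, 1198, 1703, 437, 796, 1228, 450, 1442, 1306, 822, 1687, 139, 602,
     454, 1569, 526, 1361, 293, 982, 926, 1211, 1534, 1471, 1088, 1470, 1233, 835, 1196, 1702, 558, 252, 1380, 213,
     1268, 1544, 1252, 1237, 861, 287, 1817, 374, 1812, 308, 1313, 1501, 1547, 37, 36, 1777, 1783, 650, 1144, 424,
     1450, 1183, 255, 1795, 840, 1349, 369, 1616, 1672, 19, 1599, 228, 968, 1213, 140, 267, 58, 1705, 698, 1171,
     567, 40, 194, 1572, 234, 1240, 138, 1680, 1029, 1218, 422, 563, 1128, 1157, 107, 1232, 862, 919, 1373, 546,
     1472, 1718, 85, 1627, 739, 1717, 112, 244, 1039, 1715, 1707, 1186, 297, 1514, 364, 589, 811, 409, 864, 406,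
     153, 154, 1360, 1293, 1761, 1624, 549, 1665, 820, 516, 1254, 1521, 959, 6, 1339, 969, 672, 251, 1303, 474,
     1280, 1720, 817, 605, 1398, 1728, 1331, 77, 125, 1241, 1813, 63, 1636, 514, 365, 895, 1036, 1374, 456, 770,
     569, 1467, 241, 97, 1734, 789, 652, 648, 1143, 1738, 10, 1800, 1335, 1033, 723, 1676, 1671, 714, 343, 3, 575,
     842, 326, 914, 1250, 1535, 1752, 1309, 761, 191, 838, 1696, 1598, 869, 1430, 520, 1826, 1334, 572, 38, 1329,
     1523, 50, 1509, 42, 469, 523, 616, 214, 210, 503, 807, 791, 696, 1072, 751, 1682, 156, 1225, 1139, 637, 1074,
     1187, 475, 720, 150, 1298, 1763, 1008, 479, 936, 615, 641, 1585, 1012, 1630, 313, 1155, 1468, 1362, 1153,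
     1650, 1635, 121, 1064, 1667, 925, 1119, 1140, 1093, 87, 1084, 608, 1142, 1025, 511, 62, 357, 1571, 1231, 888,
     860, 1154, 1495, 1095, 215, 634, 1123, 629, 75, 816, 1493, 727, 1674, 164, 294, 413, 1673, 1220, 849, 541,
     421, 1417, 115, 1069, 1483, 1578, 1753, 500]"
    by code_simp
  from deficiency_order_base[OF this] show ?thesis by simp
qed

definition ruler33 :: "int list" where
  "ruler33 =
    [0, 20, 54, 105, 107, 119, 140, 164, 220, 261, 262, 290, 322, 394, 484, 500, 511, 547, 555, 573, 578, 595, 647,
     724, 743, 782, 792, 807, 873, 910, 916, 919, 923]"

lemma deficiency_order_33_2081: "deficiency_order 33 (2 * 2081)"
proof -
  have "base_check 33 2081 ruler33 [(1, 16), (4, 14), (8, 20), (3, 9), (2, 7)] 11 []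
    [65, 75, 567, 825, 824, 1091, 593, 671, 937, 38, 286, 2017, 564, 1219, 1799, 1475, 1917, 1411, 1450, 1936,
     1046, 366, 320, 1341, 1108, 280, 2056, 1368, 1660, 1667, 635, 64, 1522, 917, 1054, 1523, 1963, 789, 2007, 284,
     1780, 1067, 2078, 161, 12, 1436, 823, 374, 1877, 1443, 1165, 904, 1830, 1692, 1126, 971, 541, 941, 109, 1259,
     124, 1333, 2048, 349, 1687, 897, 1244, 336, 1567, 1222, 1040, 1006, 1516, 900, 1916, 1540, 478, 370, 1636,
     1001, 1689, 1351, 867, 1462, 291, 1360, 898, 403, 580, 532, 739, 1639, 1500, 171, 319, 1376, 640, 159, 1227,
     802, 116, 526, 1850, 1708, 737, 1161, 1053, 1900, 340, 1746, 92, 2003, 1776, 304, 293, 531, 854, 936, 94,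
     1833, 1513, 1025, 297, 222, 1078, 378, 1129, 1762, 816, 1988, 1997, 648, 1537, 748, 1898, 352, 815, 1897, 480,
     362, 763, 1132, 870, 87, 1370, 1107, 1110, 1528, 1497, 1015, 1382, 1761, 836, 1261, 133, 527, 892, 1384, 1915,
     690, 486, 508, 279, 1558, 1702, 1380, 977, 574, 98, 438, 180, 1627, 127, 924, 1532, 584, 1409, 794, 40, 1338,
     1619, 826, 2009, 339, 751, 973, 1036, 538, 734, 185, 783, 1479, 1713, 1433, 1968, 1987, 496, 709, 1517, 345,
     117, 609, 1504, 1386, 516, 1624, 72, 1856, 122, 1137, 1672, 1103, 1223, 1225, 1373, 1484, 1361, 2041, 637,
     860, 287, 1350, 700, 48, 1331, 1853, 343, 285, 246, 1020, 1698, 1906, 1568, 49, 146, 212, 1920, 695, 932,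
     1277, 1538, 964, 176, 518, 1097, 945, 1741, 1533, 837, 457, 415, 1775, 1520, 1089, 1257, 69, 51, 1105, 233,
     503, 1509, 1147, 596, 1733, 1792, 1524, 1738, 1381, 1325, 594, 982, 1002, 468, 1180, 327, 698, 313, 1119,
     1293, 1843, 1905, 1675, 202, 1957, 289, 281, 1659, 2023, 238, 1881, 2004, 307, 455, 1529, 1899, 190, 147,
     2000, 2040, 1316, 1918, 1130, 1486, 591, 938, 983, 598, 23, 333, 1740, 1684, 482, 879, 1610, 114, 1821, 679,
     1600, 1840, 1178, 856, 1956, 1514, 115, 1205, 524, 33, 1248, 433, 1109, 657, 1016, 224, 416, 1019, 150, 1580,
     1512, 1725, 1554, 198, 630, 131, 71, 1827, 881, 1789, 156, 1597, 890, 1416, 1640, 1778, 1628, 1543, 1507, 379,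
     494, 1590, 263, 242, 467, 1677, 232, 1395, 934, 833, 1958, 1302, 1798, 509, 670, 1707, 200, 1930, 684, 303,
     325, 454, 749, 34, 372, 979, 750, 1709, 510, 1727, 1841, 1501, 1743, 876, 507, 1168, 1553, 1946, 649, 223,
     1867, 2076, 1555, 501, 121, 1844, 1772, 548, 1285, 253, 1615, 239, 1995, 274, 1423, 259, 1651, 1609, 1921,
     877, 967, 1965, 624, 1873, 1133, 201, 2055, 1621, 1415, 1452, 1784, 1613, 1142, 1167, 1980, 1879, 423, 1114,
     432, 1962, 1008, 1446, 1023, 359, 1911, 1464, 882, 1010, 329, 1159, 2065, 306, 1826, 616, 1521, 1004, 1751,
     965, 810, 1697, 1722, 1774, 1705, 1234, 1429, 1630, 650, 91, 521, 1246, 1753, 1950, 928, 1700, 674, 559, 857,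
     1272, 182, 2045, 1052, 1472, 1292, 228, 1616, 1193, 920, 718, 562, 255, 375, 1710, 1440, 661, 632, 1969, 1009,
     1314, 424, 1099, 1189, 1485, 1548, 1367, 571, 1224, 1204, 1014, 736, 434, 701, 1695, 1297, 73, 1788]
    [1718, 1986, 1880, 390, 828, 1307, 2052, 449, 1912, 1451, 245, 1149, 405, 1063, 1407, 1870, 687, 1207, 74, 587,
     1645, 689, 1354, 1869, 619, 177, 2059, 1536, 225, 781, 1829, 1665, 52, 1765, 215, 204, 1721, 1117, 1715, 1127,
     331, 453, 277, 1526, 1032, 1584, 365, 544, 1031, 1453, 1322, 933, 2015, 1676, 346, 1162, 929, 272, 68, 1083,
     387, 1011, 1482, 308, 935, 899, 851, 1815, 348, 26, 37, 1330, 2063, 1541, 1851, 757, 755, 178, 210, 1701,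
     1027, 1574, 1334, 1895, 487, 774, 1910, 602, 1466, 1417, 458, 1050, 1061, 317, 1473, 597, 662, 1238, 1088,
     1077, 5, 206, 1377, 1230, 1306, 358, 957, 1782, 316, 1996, 1984, 323, 1194, 93, 1679, 1562, 1457, 703, 1461,
     1209, 1309, 384, 1255, 1612, 626, 2072, 987, 714, 1076, 588, 1614, 638, 217, 1669, 1160, 413, 1455, 1979, 250,
     1289, 1606, 1284, 2027, 477, 1005, 966, 1816, 399, 1113, 1157, 1577, 1232, 1954, 1938, 136, 385, 1295, 769,
     1075, 1939, 78, 1201, 1439, 1216, 214, 721, 183, 1206, 1138, 719, 1164, 811, 1557, 699, 2037, 779, 32, 1044,
     729, 2035, 1760, 1471, 268, 1175, 1235, 1591, 1811, 203, 1172, 1241, 273, 1210, 342, 1814, 663, 10, 27, 1326,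
     631, 1139, 691, 24, 189, 1048, 732, 436, 888, 606, 1398, 481, 1641, 1534, 1215, 1104, 1480, 756, 1914, 862,
     1427, 1970, 1657, 1378, 392, 560, 697, 1094, 208, 1038, 615, 165, 353, 1220, 151, 97, 914, 39, 1456, 884, 252,
     355, 1806, 367, 2028, 1852, 1589, 1339, 112, 1383, 422, 1492, 1823, 1467, 1299, 1428, 1637, 132, 1511, 954,
     777, 1728, 1266, 312, 576, 1724, 1402, 1796, 853, 693, 278, 128, 1887, 491, 76, 1420, 1424, 1813, 28, 1745,
     850, 447, 561, 1253, 952, 552, 149, 1773, 130, 710, 1489, 1134, 1185, 610, 993, 688, 1585, 539, 830, 335, 170,
     772, 195, 822, 318, 227, 829, 1842, 1977, 795, 985, 1247, 437, 1056, 744, 883, 1888, 813, 1494, 1033, 1242,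
     1872, 456, 314, 844, 1081, 1927, 997, 1365, 745, 1066, 47, 2068, 798, 817, 655, 1313, 1007, 1122, 1279, 1144,
     940, 1017, 530, 269, 1062, 412, 1447, 1069, 330, 1269, 1889, 1135, 1732, 15, 237, 2002, 1090, 1551, 621, 814,
     1158, 1544, 1298, 1925, 60, 411, 639, 1982, 546, 1757, 1198, 1596, 875, 1233, 1013, 162, 145, 1369, 1058,
     1195, 14, 582, 2016, 167, 2021, 490, 1588, 1855, 948, 842, 1145, 633, 1414, 488, 1470, 1317, 534, 1620, 1125,
     264, 1171, 753, 1106, 785, 1935, 913, 1750, 1575, 942, 864, 1662, 722, 716, 21, 235, 991, 998, 658, 1817, 947,
     1432, 1649, 1064, 778, 554, 525, 989, 505, 1311, 868, 1229, 634, 1618, 905, 22, 1622, 474, 380, 1476, 395,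
     111, 843, 994, 1018, 622, 1251, 1832, 1864, 144, 240, 2079, 692, 1477, 1561, 1703, 2019, 1182, 767, 42, 1490,
     1250, 1493, 1179, 950, 1400, 2080, 669, 459, 1098, 90, 1340, 1902, 2008, 776, 226, 1459, 1197, 628, 885, 1807,
     1498, 1834, 1024, 1605, 1282, 102, 1288, 448, 57, 2013, 1080, 2032, 958, 629, 168, 1863, 1586, 1519, 708, 139,
     1319, 1353, 341, 1635, 1324, 1211, 1570, 2001, 812, 1012, 514, 1258, 1719]"
    by code_simp
  from deficiency_order_base[OF this] show ?thesis by simp
qed

lemma deficiency_order_33_2087: "deficiency_order 33 (2 * 2087)"
proof -
  have "base_check 33 2087 ruler33 [(1, 16), (4, 14), (8, 20), (3, 9), (2, 7)] 11 [(886, 1102)]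
    [549, 689, 499, 1237, 1489, 1335, 1867, 1462, 534, 1324, 1111, 609, 581, 1506, 1698, 1195, 1022, 1482, 1052,
     1853, 347, 1738, 1584, 1504, 1634, 1706, 39, 997, 1064, 572, 1036, 1882, 1496, 836, 303, 757, 1664, 416, 427,
     1747, 217, 1206, 1132, 1391, 161, 197, 1558, 2064, 1207, 1421, 974, 147, 933, 1051, 875, 643, 1581, 1168, 260,
     1533, 1594, 1403, 1274, 1327, 371, 1848, 1687, 1025, 725, 666, 136, 1660, 983, 863, 1469, 97, 1385, 769, 1837,
     1372, 343, 848, 176, 429, 144, 1310, 1070, 1828, 323, 1189, 1178, 339, 1924, 1686, 1813, 722, 254, 69, 1002,
     419, 631, 998, 829, 1967, 1241, 1897, 1814, 1669, 729, 1388, 2016, 487, 1942, 395, 1158, 1993, 1097, 282, 27,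
     1521, 101, 877, 1879, 1717, 418, 1951, 52, 640, 397, 1366, 1539, 420, 116, 1910, 202, 1348, 800, 793, 926,
     1773, 195, 1920, 789, 438, 431, 803, 913, 475, 1262, 985, 952, 1915, 76, 1604, 210, 38, 880, 172, 607, 1323,
     864, 1876, 266, 826, 1750, 104, 786, 1325, 1423, 1124, 539, 516, 1236, 385, 509, 1748, 758, 1991, 1880, 987,
     1610, 72, 46, 1312, 1121, 1269, 955, 1271, 433, 1332, 1015, 413, 1033, 1162, 1183, 1295, 1616, 1078, 920,
     1847, 1205, 370, 521, 1452, 401, 444, 1035, 833, 298, 1633, 1497, 400, 1605, 1631, 2001, 1733, 1404, 1293,
     1710, 1599, 532, 273, 1430, 558, 212, 42, 449, 1444, 1193, 1383, 1900, 246, 435, 330, 1790, 1933, 644, 701,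
     664, 616, 1188, 796, 188, 681, 541, 209, 1038, 317, 1112, 1646, 232, 1454, 1503, 738, 96, 918, 332, 994, 83,
     1453, 410, 1247, 1541, 268, 1781, 490, 536, 2077, 478, 1701, 1000, 1688, 50, 1833, 837, 1265, 625, 809, 1113,
     47, 231, 1420, 845, 841, 120, 791, 1549, 692, 1514, 1457, 1010, 1643, 1637, 1485, 1741, 1156, 1974, 1834,
     1694, 1058, 1155, 1196, 1598, 311, 342, 1658, 815, 1884, 1579, 264, 1768, 783, 1588, 1292, 1410, 2052, 1020,
     817, 924, 1544, 563, 112, 1772, 508, 2078, 1245, 1436, 1959, 1023, 1179, 946, 740, 962, 1608, 163, 335, 1095,
     690, 1270, 577, 1211, 204, 911, 575, 1928, 1731, 2003, 1153, 523, 1198, 1371, 249, 2000, 1779, 1705, 1468,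
     179, 73, 788, 1268, 462, 1546, 436, 1089, 1681, 1003, 649, 1603, 1529, 5, 256, 1707, 1299, 1849, 182, 753,
     456, 1936, 1905, 1988, 1212, 60, 489, 1812, 703, 2047, 1977, 1765, 1808, 652, 360, 622, 529, 816, 1944, 243,
     732, 943, 1788, 552, 715, 1537, 2083, 1220, 1117, 704, 346, 1821, 1239, 1749, 390, 1589, 448, 1101, 275, 2015,
     31, 893, 1143, 485, 1583, 1530, 316, 57, 1108, 1806, 486, 1080, 1728, 1191, 463, 2065, 1679, 1804, 1742, 2063,
     170, 1209, 2026, 1547, 949, 1996, 329, 103, 604, 425, 1520, 697, 1871, 1254, 1596, 1690, 59, 32, 1767, 1696,
     1666, 1466, 586, 1820, 2071, 1152, 543, 723, 295, 111, 1316, 1826, 694, 1927, 2072, 1024, 660, 888, 1249, 912,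
     1273, 621, 296, 85, 1477, 1031, 1730, 128, 114, 1258, 1455, 936, 1868, 944, 869, 1969, 1067, 200, 1528, 1763,
     1381, 337, 134, 676, 168, 495, 1131, 1560, 1094, 1938, 1794, 733, 1257, 2027, 1784, 1745, 801, 1816, 1470]
    [1907, 1807, 15, 1084, 149, 53, 1799, 285, 477, 1311, 1256, 446, 1722, 302, 471, 1831, 1004, 242, 1107, 186,
     745, 480, 1442, 241, 961, 2038, 1419, 1337, 1144, 1998, 70, 870, 1835, 1829, 1099, 881, 891, 318, 904, 2048,
     340, 1981, 1322, 1692, 1987, 1796, 162, 452, 1538, 1613, 1177, 1943, 900, 2002, 844, 953, 1629, 1072, 359,
     630, 675, 1405, 1614, 1676, 1595, 1957, 601, 1753, 476, 79, 98, 130, 882, 1069, 2011, 728, 1852, 1221, 1309,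
     481, 1564, 1331, 1150, 691, 1569, 1662, 417, 986, 382, 569, 1418, 542, 1972, 1350, 1543, 886, 392, 1219, 1360,
     1787, 1930, 118, 1857, 276, 705, 1296, 1964, 455, 1063, 1286, 831, 281, 1428, 389, 1255, 794, 1803, 102, 18,
     1210, 350, 299, 437, 1795, 263, 1305, 992, 1382, 1059, 1674, 964, 309, 1775, 1087, 658, 2040, 1137, 56, 614,
     2033, 1725, 1761, 562, 958, 754, 2069, 1106, 356, 1459, 1486, 1926, 1083, 1138, 16, 1935, 271, 945, 1516, 132,
     1971, 776, 806, 687, 540, 1979, 183, 1950, 1556, 267, 632, 1407, 1142, 1317, 1508, 876, 248, 1590, 613, 1985,
     1440, 1397, 1913, 603, 1830, 23, 1248, 49, 1461, 333, 853, 2049, 203, 1460, 358, 313, 229, 993, 34, 2042, 752,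
     661, 1008, 1574, 158, 2059, 2045, 546, 1285, 402, 345, 1721, 1566, 17, 1175, 214, 259, 503, 1856, 1125, 980,
     14, 1554, 959, 799, 637, 1091, 1304, 1448, 651, 1526, 1450, 1001, 492, 1228, 1318, 2028, 1202, 189, 2082, 137,
     868, 1797, 216, 1231, 565, 1509, 424, 1109, 1349, 1308, 1073, 1085, 1426, 1451, 1055, 238, 288, 1368, 597,
     669, 914, 766, 611, 2010, 1615, 744, 1054, 1375, 1279, 8, 133, 294, 925, 659, 588, 377, 1233, 124, 2022, 668,
     843, 1559, 861, 279, 1490, 1832, 1213, 454, 51, 440, 731, 1618, 762, 373, 849, 1086, 1718, 1376, 1578, 95,
     1535, 515, 1896, 883, 1384, 78, 2075, 1244, 1260, 1123, 1017, 1875, 2056, 305, 1200, 2070, 77, 519, 1523, 718,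
     1782, 1373, 1617, 1092, 589, 1892, 1439, 979, 2062, 1663, 1047, 818, 928, 1818, 501, 1611, 1049, 180, 1997,
     1786, 2057, 1447, 835, 1607, 1932, 634, 1619, 93, 1474, 211, 1180, 1739, 1565, 1306, 1531, 557, 1983, 1133,
     683, 620, 1314, 1510, 1591, 1243, 155, 1090, 1854, 213, 748, 1872, 968, 1431, 865, 1176, 292, 1472, 1597, 141,
     472, 1481, 1682, 386, 1353, 665, 326, 970, 636, 576, 131, 1642, 662, 1758, 1732, 1714, 890, 1369, 1412, 2018,
     1693, 767, 1298, 639, 460, 1275, 126, 820, 314, 1037, 525, 7, 2008, 1018, 274, 82, 582, 2058, 1678, 63, 451,
     1096, 1007, 1947, 336, 1677, 1224, 773, 1846, 554, 1562, 1100, 1965, 376, 1593, 11, 528, 1771, 717, 1986,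
     2007, 171, 561, 1949, 770, 1199, 21, 1752, 353, 272, 1492, 1340, 1817, 277, 1229, 181, 1909, 43, 1903, 1406,
     468, 1336, 1858, 915, 1386, 878, 25, 474, 1437, 1648, 699, 2017, 939, 627, 1712, 1307, 1445, 759, 35, 1545,
     726, 1479, 1068, 19, 1895, 1278, 858, 357, 1184, 283, 184, 772, 1077, 755, 1401, 1984, 1798, 682, 129, 24,
     1561, 1321, 988, 1409, 227, 470, 677, 1980, 64, 1129, 251, 685, 80, 827]"
    by code_simp
  from deficiency_order_base[OF this] show ?thesis by simp
qed

text \<open>
  With \<open>w + 1 = 2 h\<close>, admissibility says that 3 divides \<open>r (2h - r)\<close>. In terms
  of the half-order \<open>V = r + h\<close> this is \<open>V \<equiv> h\<close> or \<open>V \<equiv>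
  0\<close> modulo 3, the two classes that the recursion reaches from \<open>a \<equiv> h\<close>.
\<close>
lemma PENT_for_large_degrees:
  assumes a: "deficiency_order w (2 * a)" and b: "deficiency_order w (2 * b)"
    and cop: "coprime a 6" "coprime b 6" "coprime a b" and ab: "a mod 3 = b mod 3"
    and w: "3 \<le> w" "w + 1 = 2 * h" and h: "a mod 3 = h mod 3"
  shows "\<exists>r0. \<forall>r\<ge>r0. admissible 3 w r \<longrightarrow>
     (\<exists>(P :: nat set) L. PENT 3 r w P L \<and> girth (deficiency_adj P L) \<ge> 5)"
proof (intro exI[of _ "432 * a * b + 9 * a"] allI impI)
  fix r assume r: "432 * a * b + 9 * a \<le> r" and adm: "admissible 3 w r"
  have "int w + 1 - int r = 2 * int h - int r" using w by linarith
  then have "3 dvd int r * (2 * int h - int r)"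
    using adm by (simp add: admissible_def cong_0_iff)
  then have "3 dvd int r \<or> 3 dvd 2 * int h - int r"
    by (subst (asm) prime_dvd_mult_iff) auto
  then have "(r + h) mod 3 = 0 \<or> (r + h) mod 3 = h mod 3" by presburger
  then have "deficiency_order w (2 * (r + h))"
    using r h by (intro deficiency_order_all_large[OF a b cop ab]) auto
  then obtain P :: "nat set" and E t where P: "deficiency_op w P E t" "card P = 2 * (r + h)"
    unfolding deficiency_order_def by blast
  then have "card P = 2 * r + w + 1" using w by simp
  from deficiency_op_imp_PENT[OF P(1) w(1) this]
  show "\<exists>(P :: nat set) L. PENT 3 r w P L \<and> girth (deficiency_adj P L) \<ge> 5" by blast
qed

theorem theorem3p5:
  "\<forall>w \<in> {25, 27, 31, 33 :: nat}. \<exists>r0 :: nat. \<forall>r \<ge> r0. admissible 3 w r \<longrightarrow>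
     (\<exists>(P :: nat set) L. PENT 3 r w P L \<and> girth (deficiency_adj P L) \<ge> 5)"
proof
  fix w :: nat assume "w \<in> {25, 27, 31, 33}"
  then consider "w = 25" | "w = 27" | "w = 31" | "w = 33" by blast
  then show "\<exists>r0 :: nat. \<forall>r \<ge> r0. admissible 3 w r \<longrightarrow>
     (\<exists>(P :: nat set) L. PENT 3 r w P L \<and> girth (deficiency_adj P L) \<ge> 5)"
  proof cases
    case 1
    show ?thesis unfolding 1
      by (rule PENT_for_large_degrees[OF deficiency_order_25_1177 deficiency_order_25_1183, where h = 13])
        (simp_all add: coprime_iff_gcd_eq_1 gcd_non_0_nat)
  next
    case 2
    show ?thesis unfolding 2
      by (rule PENT_for_large_degrees[OF deficiency_order_27_1379 deficiency_order_27_1385, where h = 14])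
        (simp_all add: coprime_iff_gcd_eq_1 gcd_non_0_nat)
  next
    case 3
    show ?thesis unfolding 3
      by (rule PENT_for_large_degrees[OF deficiency_order_31_1831 deficiency_order_31_1837, where h = 16])
        (simp_all add: coprime_iff_gcd_eq_1 gcd_non_0_nat)
  next
    case 4
    show ?thesis unfolding 4
      by (rule PENT_for_large_degrees[OF deficiency_order_33_2081 deficiency_order_33_2087, where h = 17])
        (simp_all add: coprime_iff_gcd_eq_1 gcd_non_0_nat)
  qed
qed

end
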